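(* Let $U\subseteq R_{2,1}$ be a basepoint free four-dimensional subspace such that $I_U$ has a unique linear first syzygy of bidegree $(0,1)$, and let the basis $p_0,\dots,p_3$ of $U$ be in the normal form of Case 1 or Case 2 of the context (which can always be achieved by a linear change of the variables $s,t$ and a choice of basis). Then the corresponding complex \[0\longrightarrow R(-4,-2)^2\xrightarrow{\phi_3}R(-2,-2)\oplus R(-3,-2)^2\oplus R(-4,-1)^2\xrightarrow{\phi_2}R(-2,-1)^4\xrightarrow{[p_0\,p_1\,p_2\,p_3]}I_U\longrightarrow 0\] with $\phi_2,\phi_3$ as in the context is exact.
   Context: $k$ is an algebraically closed field and $R=k[s,t,u,v]$ is bigraded with $s,t$ of degree $(1,0)$ and $u,v$ of degree $(0,1)$; $R_{m,n}$ is the graded piece of bidegree $(m,n)$. $U=\mathrm{Span}\{p_0,p_1,p_2,p_3\}\subseteq R_{2,1}$ is a four-dimensional subspace and $I_U=\langle p_0,p_1,p_2,p_3\rangle$. $U$ is basepoint free if the $p_i$ have no common zero on $\mathbb{P}^1\times\mathbb{P}^1$, i.e. $\sqrt{I_U}=\langle s,t\rangle\cap\langle u,v\rangle$. A first syzygy of bidegree $(a,b)$ is a nonzero $(g_i)\in R_{a,b}^4$ with $\sum g_ip_i=0$; "unique" means unique up to nonzero scalar. Normal forms. Let $l_i=a_iu+b_iv\in R_{0,1}$ ($i=1,\dots,4$), $q=l_1l_4-l_2l_3$, which is nonzero and factors as $q=L_1L_2$ with $L_i=\alpha_iu+\beta_iv$. Case 1: $p_0=s^2u$, $p_1=s^2v$,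 $p_2=stl_1+t^2l_2$, $p_3=stl_3+t^2l_4$, and \[\phi_2=\begin{bmatrix} v&\alpha_1tL_2&0&a_1st+a_2t^2&a_3st+a_4t^2\\ -u&\beta_1tL_2&0&b_1st+b_2t^2&b_3st+b_4t^2\\ 0&-sl_4&sl_3+tl_4&-s^2&0\\ 0&sl_2&-sl_1-tl_2&0&-s^2\end{bmatrix},\quad \phi_3=\begin{bmatrix}\gamma&\delta\\ s&-t\\ 0&-s\\ -l_4&-l_3\\ l_2&l_1\end{bmatrix},\] $\gamma=-\alpha_1\beta_2st+(a_1st+a_2t^2)b_4-(a_3st+a_4t^2)b_2$, $\delta=\alpha_1\beta_2t^2+(a_1st+a_2t^2)b_3-(a_3st+a_4t^2)b_1$. Case 2: $p_0=stu$, $p_1=stv$, $p_2=s^2l_1+t^2l_2$, $p_3=s^2l_3+t^2l_4$, and \[\phi_2=\begin{bmatrix} v&-\alpha_1tL_2&\alpha_1sL_2&a_1s^2+a_2t^2&a_3s^2+a_4t^2\\ -u&-\beta_1tL_2&\beta_1sL_2&b_1s^2+b_2t^2&b_3s^2+b_4t^2\\ 0&-sl_3&-tl_4&-st&0\\ 0&sl_1&tl_2&0&-st\end{bmatrix},\quad \phi_3=\begin{bmatrix}\gamma&\delta\\ 0&t\\ s&0\\ -l_4&-l_3\\ l_2&l_1\end{bmatrix},\] $\gamma=(-\alpha_1\beta_2+a_1b_4-a_3b_2)s^2+(a_2b_4-a_4b_2)t^2$, $\delta=(a_1b_3-a_3b_1)s^2+(\alpha_1\beta_2+a_2b_3-a_4b_1)t^2$.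 *)

theory Defs
  imports
    "HOL-Library.Poly_Mapping"
    "HOL-Computational_Algebra.Polynomial"
    "Jordan_Normal_Form.Matrix_Kernel"
begin

datatype var = VS | VT | VU | VV

(* The order VS < VT < VU < VV is only there so that the library's instance
   "poly_mapping :: idom" applies to bigraded_poly below. *)
instantiation var :: linorder
begin

definition var_index :: "var \<Rightarrow> nat" where
  "var_index x = (case x of VS \<Rightarrow> 0 | VT \<Rightarrow> 1 | VU \<Rightarrow> 2 | VV \<Rightarrow> 3)"

definition less_eq_var :: "var \<Rightarrow> var \<Rightarrow> bool" where
  "x \<le> y \<longleftrightarrow> var_index x \<le> var_index y"

definition less_var :: "var \<Rightarrow> var \<Rightarrow> bool" where
  "x < y \<longleftrightarrow> var_index x < var_index y"

instance
proof
  fix x y :: var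
  assume "x \<le> y" "y \<le> x"
  then show "x = y"
    by (cases x; cases y) (simp_all add: less_eq_var_def var_index_def)
qed (auto simp: less_eq_var_def less_var_def)

end

type_synonym 'k bigraded_poly = "(var \<Rightarrow>\<^sub>0 nat) \<Rightarrow>\<^sub>0 'k"

definition Cst :: "'k::comm_ring_1 \<Rightarrow> 'k bigraded_poly" where
  "Cst c = Poly_Mapping.single 0 c"

definition Var :: "var \<Rightarrow> 'k::comm_ring_1 bigraded_poly" where
  "Var x = Poly_Mapping.single (Poly_Mapping.single x 1) 1"

abbreviation "Xs \<equiv> Var VS"
abbreviation "Xt \<equiv> Var VT"
abbreviation "Xu \<equiv> Var VU"
abbreviation "Xv \<equiv> Var VV"

(* R_{m,n}; integer indices, so that the pieces of the twists R(i,j) need no case distinction. *)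
definition piece :: "int \<Rightarrow> int \<Rightarrow> 'k::comm_ring_1 bigraded_poly set" where
  "piece m n = {f. \<forall>e \<in> Poly_Mapping.keys f.
     int (Poly_Mapping.lookup e VS + Poly_Mapping.lookup e VT) = m \<and>
     int (Poly_Mapping.lookup e VU + Poly_Mapping.lookup e VV) = n}"

interpretation kvec: Vector_Spaces.vector_space
  "\<lambda>(c::'k::field) (f::'k bigraded_poly). Cst c * f"
  by unfold_locales
    (simp_all add: Cst_def algebra_simps single_add mult_single single_one flip: mult.assoc)

interpretation rmod: Modules.module
  "(*) :: 'k::comm_ring_1 bigraded_poly \<Rightarrow> 'k bigraded_poly \<Rightarrow> 'k bigraded_poly"
  by unfold_locales (simp_all add: algebra_simps)

definition is_basis :: "'k::field bigraded_poly list \<Rightarrow> 'k bigraded_poly set \<Rightarrow> bool" where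
  "is_basis p U \<longleftrightarrow> distinct p \<and> kvec.independent (set p) \<and> kvec.span (set p) = U"

(* The span of a set of ring elements in R as a module over itself is the ideal it generates. *)
abbreviation ideal_gen :: "'k::comm_ring_1 bigraded_poly list \<Rightarrow> 'k bigraded_poly set" where
  "ideal_gen p \<equiv> rmod.span (set p)"

definition eval_hom ::
    "('k::comm_ring_1 \<Rightarrow> 'b::comm_ring_1) \<Rightarrow> (var \<Rightarrow> 'b) \<Rightarrow> 'k bigraded_poly \<Rightarrow> 'b" where
  "eval_hom h x f = (\<Sum>e \<in> Poly_Mapping.keys f.
     h (Poly_Mapping.lookup f e) * (\<Prod>y \<in> Poly_Mapping.keys e. x y ^ Poly_Mapping.lookup e y))"

(* Points of P^1 x P^1 are given by homogeneous coordinates ((x VS, x VT), (x VU, x VV)). *)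
definition basepoint_free :: "'k::field bigraded_poly list \<Rightarrow> bool" where
  "basepoint_free p \<longleftrightarrow>
     \<not> (\<exists>x :: var \<Rightarrow> 'k. (x VS, x VT) \<noteq> (0, 0) \<and> (x VU, x VV) \<noteq> (0, 0) \<and>
          (\<forall>f \<in> set p. eval_hom id x f = 0))"

definition first_syzygy ::
    "'k::comm_ring_1 bigraded_poly list \<Rightarrow> int \<Rightarrow> int \<Rightarrow> 'k bigraded_poly vec \<Rightarrow> bool" where
  "first_syzygy p m n g \<longleftrightarrow>
     g \<in> carrier_vec (length p) \<and> g \<noteq> 0\<^sub>v (length p) \<and>
     (\<forall>i < length p. g $ i \<in> piece m n) \<and> (\<Sum>i < length p. g $ i * p ! i) = 0"

definition unique_first_syzygy :: "'k::field bigraded_poly list \<Rightarrow> int \<Rightarrow> int \<Rightarrow> bool" where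
  "unique_first_syzygy p m n \<longleftrightarrow>
     (\<exists>g. first_syzygy p m n g \<and>
        (\<forall>h. first_syzygy p m n h \<longrightarrow> (\<exists>c. c \<noteq> 0 \<and> h = Cst c \<cdot>\<^sub>v g)))"

definition subst_st ::
    "'k::comm_ring_1 \<Rightarrow> 'k \<Rightarrow> 'k \<Rightarrow> 'k \<Rightarrow> 'k bigraded_poly \<Rightarrow> 'k bigraded_poly" where
  "subst_st c11 c12 c21 c22 =
     eval_hom Cst (case_var (Cst c11 * Xs + Cst c12 * Xt) (Cst c21 * Xs + Cst c22 * Xt) Xu Xv)"

definition lform :: "(nat \<Rightarrow> 'k::comm_ring_1) \<Rightarrow> (nat \<Rightarrow> 'k) \<Rightarrow> nat \<Rightarrow> 'k bigraded_poly" where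
  "lform a b i = Cst (a i) * Xu + Cst (b i) * Xv"

definition qform :: "(nat \<Rightarrow> 'k::comm_ring_1) \<Rightarrow> (nat \<Rightarrow> 'k) \<Rightarrow> 'k bigraded_poly" where
  "qform a b = lform a b 1 * lform a b 4 - lform a b 2 * lform a b 3"

(* The indices 1..4 of a, b and 1, 2 of \<alpha>, \<beta> are those of the mathematical notation; other
   values of these functions are irrelevant. *)
definition normal_form1 ::
    "(nat \<Rightarrow> 'k::comm_ring_1) \<Rightarrow> (nat \<Rightarrow> 'k) \<Rightarrow> (nat \<Rightarrow> 'k) \<Rightarrow> (nat \<Rightarrow> 'k) \<Rightarrow>
     'k bigraded_poly list \<Rightarrow> bool" where
  "normal_form1 a b \<alpha> \<beta> p \<longleftrightarrow>
     p = [Xs\<^sup>2 * Xu, Xs\<^sup>2 * Xv,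
          Xs * Xt * lform a b 1 + Xt\<^sup>2 * lform a b 2,
          Xs * Xt * lform a b 3 + Xt\<^sup>2 * lform a b 4] \<and>
     qform a b = lform \<alpha> \<beta> 1 * lform \<alpha> \<beta> 2"

definition normal_form2 ::
    "(nat \<Rightarrow> 'k::comm_ring_1) \<Rightarrow> (nat \<Rightarrow> 'k) \<Rightarrow> (nat \<Rightarrow> 'k) \<Rightarrow> (nat \<Rightarrow> 'k) \<Rightarrow>
     'k bigraded_poly list \<Rightarrow> bool" where
  "normal_form2 a b \<alpha> \<beta> p \<longleftrightarrow>
     p = [Xs * Xt * Xu, Xs * Xt * Xv,
          Xs\<^sup>2 * lform a b 1 + Xt\<^sup>2 * lform a b 2,
          Xs\<^sup>2 * lform a b 3 + Xt\<^sup>2 * lform a b 4] \<and>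
     qform a b = lform \<alpha> \<beta> 1 * lform \<alpha> \<beta> 2"

definition phi2_case1 ::
    "(nat \<Rightarrow> 'k::comm_ring_1) \<Rightarrow> (nat \<Rightarrow> 'k) \<Rightarrow> (nat \<Rightarrow> 'k) \<Rightarrow> (nat \<Rightarrow> 'k) \<Rightarrow>
     'k bigraded_poly mat" where
  "phi2_case1 a b \<alpha> \<beta> = (let l = lform a b; L2 = lform \<alpha> \<beta> 2 in
     mat_of_rows_list 5
      [[Xv, Cst (\<alpha> 1) * Xt * L2, 0,
          Cst (a 1) * Xs * Xt + Cst (a 2) * Xt\<^sup>2, Cst (a 3) * Xs * Xt + Cst (a 4) * Xt\<^sup>2],
       [- Xu, Cst (\<beta> 1) * Xt * L2, 0,
          Cst (b 1) * Xs * Xt + Cst (b 2) * Xt\<^sup>2, Cst (b 3) * Xs * Xt + Cst (b 4) * Xt\<^sup>2],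
       [0, - (Xs * l 4), Xs * l 3 + Xt * l 4, - (Xs\<^sup>2), 0],
       [0, Xs * l 2, - (Xs * l 1) - Xt * l 2, 0, - (Xs\<^sup>2)]])"

definition phi3_case1 ::
    "(nat \<Rightarrow> 'k::comm_ring_1) \<Rightarrow> (nat \<Rightarrow> 'k) \<Rightarrow> (nat \<Rightarrow> 'k) \<Rightarrow> (nat \<Rightarrow> 'k) \<Rightarrow>
     'k bigraded_poly mat" where
  "phi3_case1 a b \<alpha> \<beta> = (let l = lform a b;
     A12 = Cst (a 1) * Xs * Xt + Cst (a 2) * Xt\<^sup>2;
     A34 = Cst (a 3) * Xs * Xt + Cst (a 4) * Xt\<^sup>2;
     \<gamma> = - (Cst (\<alpha> 1 * \<beta> 2) * Xs * Xt) + A12 * Cst (b 4) - A34 * Cst (b 2);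
     \<delta> = Cst (\<alpha> 1 * \<beta> 2) * Xt\<^sup>2 + A12 * Cst (b 3) - A34 * Cst (b 1) in
     mat_of_rows_list 2
      [[\<gamma>, \<delta>],
       [Xs, - Xt],
       [0, - Xs],
       [- l 4, - l 3],
       [l 2, l 1]])"

definition phi2_case2 ::
    "(nat \<Rightarrow> 'k::comm_ring_1) \<Rightarrow> (nat \<Rightarrow> 'k) \<Rightarrow> (nat \<Rightarrow> 'k) \<Rightarrow> (nat \<Rightarrow> 'k) \<Rightarrow>
     'k bigraded_poly mat" where
  "phi2_case2 a b \<alpha> \<beta> = (let l = lform a b; L2 = lform \<alpha> \<beta> 2 in
     mat_of_rows_list 5
      [[Xv, - (Cst (\<alpha> 1) * Xt * L2), Cst (\<alpha> 1) * Xs * L2,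
          Cst (a 1) * Xs\<^sup>2 + Cst (a 2) * Xt\<^sup>2, Cst (a 3) * Xs\<^sup>2 + Cst (a 4) * Xt\<^sup>2],
       [- Xu, - (Cst (\<beta> 1) * Xt * L2), Cst (\<beta> 1) * Xs * L2,
          Cst (b 1) * Xs\<^sup>2 + Cst (b 2) * Xt\<^sup>2, Cst (b 3) * Xs\<^sup>2 + Cst (b 4) * Xt\<^sup>2],
       [0, - (Xs * l 3), - (Xt * l 4), - (Xs * Xt), 0],
       [0, Xs * l 1, Xt * l 2, 0, - (Xs * Xt)]])"

definition phi3_case2 ::
    "(nat \<Rightarrow> 'k::comm_ring_1) \<Rightarrow> (nat \<Rightarrow> 'k) \<Rightarrow> (nat \<Rightarrow> 'k) \<Rightarrow> (nat \<Rightarrow> 'k) \<Rightarrow>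
     'k bigraded_poly mat" where
  "phi3_case2 a b \<alpha> \<beta> = (let l = lform a b;
     \<gamma> = Cst (- \<alpha> 1 * \<beta> 2 + a 1 * b 4 - a 3 * b 2) * Xs\<^sup>2 + Cst (a 2 * b 4 - a 4 * b 2) * Xt\<^sup>2;
     \<delta> = Cst (a 1 * b 3 - a 3 * b 1) * Xs\<^sup>2 + Cst (\<alpha> 1 * \<beta> 2 + a 2 * b 3 - a 4 * b 1) * Xt\<^sup>2 in
     mat_of_rows_list 2
      [[\<gamma>, \<delta>],
       [0, Xt],
       [Xs, 0],
       [- l 4, - l 3],
       [l 2, l 1]])"

(* For d = [(i_1,j_1),...,(i_r,j_r)], the piece of bidegree (m,n) of R(i_1,j_1) + ... + R(i_r,j_r),
   where R(i,j)_{m,n} = R_{m+i,n+j}. *)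
definition twist_piece :: "(int \<times> int) list \<Rightarrow> int \<Rightarrow> int \<Rightarrow> 'k::comm_ring_1 bigraded_poly vec set" where
  "twist_piece d m n =
     {x \<in> carrier_vec (length d). \<forall>j < length d. x $ j \<in> piece (m + fst (d ! j)) (n + snd (d ! j))}"

definition graded_map ::
    "'k::comm_ring_1 bigraded_poly mat \<Rightarrow> (int \<times> int) list \<Rightarrow> (int \<times> int) list \<Rightarrow> bool" where
  "graded_map A d e \<longleftrightarrow> A \<in> carrier_mat (length e) (length d) \<and>
     (\<forall>m n. \<forall>x \<in> twist_piece d m n. A *\<^sub>v x \<in> twist_piece e m n)"

definition mat_image :: "'a::comm_ring_1 mat \<Rightarrow> 'a vec set" where
  "mat_image A = (\<lambda>x. A *\<^sub>v x) ` carrier_vec (dim_col A)"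

(* Exactness of 0 -> F3 -> F2 -> F1 -> ideal_gen p -> 0 as a complex of bigraded R-modules, for
   the free modules with twists d3, d2, d1 and last map [p_0 ... p_r], viewed as a 1-row matrix
   into R^1 = R. The kernel condition at each spot includes that consecutive maps compose to 0. *)
definition exact_resolution ::
    "'k::comm_ring_1 bigraded_poly list \<Rightarrow> (int \<times> int) list \<Rightarrow> (int \<times> int) list \<Rightarrow> (int \<times> int) list \<Rightarrow>
     'k bigraded_poly mat \<Rightarrow> 'k bigraded_poly mat \<Rightarrow> bool" where
  "exact_resolution p d3 d2 d1 \<phi>3 \<phi>2 \<longleftrightarrow> (let \<phi>1 = mat_of_rows_list (length p) [p] in
     graded_map \<phi>3 d3 d2 \<and> graded_map \<phi>2 d2 d1 \<and> graded_map \<phi>1 d1 [(0, 0)] \<and>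
     mat_kernel \<phi>3 = {0\<^sub>v (dim_col \<phi>3)} \<and>
     mat_kernel \<phi>2 = mat_image \<phi>3 \<and>
     mat_kernel \<phi>1 = mat_image \<phi>2 \<and>
     (\<lambda>y. y $ 0) ` mat_image \<phi>1 = ideal_gen p)"

end

theory Submission
  imports Defs
begin

text \<open>Writing a linear syzygy as \<open>(x\<^sub>i u + y\<^sub>i v)\<close>, the elements \<open>P = \<Sum> x\<^sub>i p\<^sub>i\<close> and
  \<open>Q = \<Sum> y\<^sub>i p\<^sub>i\<close> of \<open>U\<close> satisfy \<open>u P + v Q = 0\<close>, so \<open>P = v B\<close> and \<open>Q = - u B\<close> for a quadratic
  form \<open>B\<close> in \<open>s, t\<close>. Hence \<open>U\<close> contains \<open>B u\<close> and \<open>B v\<close>, and the two normal forms arise according to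
  whether \<open>B\<close> is a square or has distinct roots. Being basepoint free makes the coefficients \<open>l\<^sub>2, l\<^sub>4\<close>
  of \<open>t\<^sup>2\<close> (and in Case 2 also \<open>l\<^sub>1, l\<^sub>3\<close>) linearly independent. If \<open>q\<close> were zero, \<open>(0, 0, l\<^sub>4, - l\<^sub>2)\<close>
  would be a second linear syzygy.

  Exactness is then divisibility in the polynomial ring: \<open>s\<close> and \<open>t\<close> are prime, and modulo \<open>s\<close> the only
  syzygy of \<open>l\<^sub>2, l\<^sub>4\<close> is \<open>(- l\<^sub>4, l\<^sub>2)\<close>. Reducing a syzygy of the \<open>p\<^sub>i\<close> modulo \<open>s\<close> and \<open>t\<close> one
  subtracts multiples of the columns of \<open>\<phi>\<^sub>2\<close> until only a multiple of \<open>(v, - u, 0, 0)\<close> is left.\<close>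

section \<open>Evaluation homomorphisms and primality of the variables\<close>

text \<open>The interpretations in the definitions made these simplification rules, and they loop with
  \<open>mult.assoc\<close>. Below, \<open>Groebner_Basis.algebra\<close> is qualified because HOL-Algebra has a proof
  method of the same base name.\<close>

declare rmod.scale_scale [simp del] kvec.scale_scale [simp del]

lemma UNIV_var: "(UNIV :: var set) = {VS, VT, VU, VV}"
  using var.exhaust by auto

text \<open>Variables outside the keys of \<open>e\<close> have exponent 0 and contribute the factor
  1. With a fixed index set the product is visibly multiplicative in \<open>e\<close>.\<close>

lemma prod_keys_var:
  fixes x :: "var \<Rightarrow> 'b::comm_ring_1"
  shows "(\<Prod>y \<in> Poly_Mapping.keys e. x y ^ Poly_Mapping.lookup e y) =
    (\<Prod>y \<in> {VS, VT, VU, VV}. x y ^ Poly_Mapping.lookup e y)"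
proof -
  have "finite (UNIV :: var set)" by (simp add: UNIV_var)
  then show ?thesis
    unfolding UNIV_var[symmetric] by (intro prod.mono_neutral_left) (auto simp: in_keys_iff)
qed

lemma poly_eq_sum_monomials:
  "f = (\<Sum>e \<in> Poly_Mapping.keys f. Poly_Mapping.single e (Poly_Mapping.lookup f e))"
  by (rule poly_mapping_eqI)
    (simp add: lookup_sum lookup_single when_def in_keys_iff)

lemma poly_single_induct [case_names single sum]:
  fixes f :: "'a \<Rightarrow>\<^sub>0 'b::comm_monoid_add"
  assumes "\<And>e c. P (Poly_Mapping.single e c)" "\<And>f g. P f \<Longrightarrow> P g \<Longrightarrow> P (f + g)"
  shows "P f"
proof -
  have "P (\<Sum>e \<in> A. Poly_Mapping.single e (Poly_Mapping.lookup f e))" if "finite A" for A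
    \<comment> \<open>A zero coefficient makes the monomial 0, which settles the empty sum.\<close>
    using that by induction (use assms assms(1)[of undefined 0] in auto)
  from this[OF finite_keys] show ?thesis
    by (subst poly_eq_sum_monomials)
qed

text \<open>Coefficient maps for which \<open>eval_hom\<close> is a ring homomorphism.
  \<open>id\<close> gives evaluation at a point, \<open>Cst\<close> gives substitution of
  polynomials for the variables.\<close>

locale coeff_hom =
  fixes h :: "'k::comm_ring_1 \<Rightarrow> 'b::comm_ring_1"
  assumes h_add [simp]: "h (a + b) = h a + h b"
    and h_mult [simp]: "h (a * b) = h a * h b"
    and h_one [simp]: "h 1 = 1"
begin

lemma h_zero [simp]: "h 0 = 0"
  using h_add[of 0 0] by simp

lemma h_uminus [simp]: "h (- a) = - h a"
  using h_add[of a "- a"] by (simp add: eq_neg_iff_add_eq_0 add.commute)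

text \<open>Cancellation may shrink the keys of a sum, so additivity calls for one finite index set
  that serves both summands and their sum.\<close>

lemma eval_hom_superset:
  assumes "finite A" "Poly_Mapping.keys f \<subseteq> A"
  shows "eval_hom h x f = (\<Sum>e \<in> A. h (Poly_Mapping.lookup f e) *
    (\<Prod>y \<in> {VS, VT, VU, VV}. x y ^ Poly_Mapping.lookup e y))"
  unfolding eval_hom_def prod_keys_var
  by (rule sum.mono_neutral_left) (use assms in \<open>auto simp: in_keys_iff\<close>)

lemma eval_hom_add [simp]: "eval_hom h x (f + g) = eval_hom h x f + eval_hom h x g"
  using eval_hom_superset[of "Poly_Mapping.keys f \<union> Poly_Mapping.keys g"] Poly_Mapping.keys_add[of f g]
  by (simp add: lookup_add algebra_simps sum.distrib)

lemma eval_hom_zero [simp]: "eval_hom h x 0 = 0"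
  by (simp add: eval_hom_def)

lemma eval_hom_single: "eval_hom h x (Poly_Mapping.single e c) =
    h c * (\<Prod>y \<in> {VS, VT, VU, VV}. x y ^ Poly_Mapping.lookup e y)"
  using eval_hom_superset[of "{e}" "Poly_Mapping.single e c"] by simp

lemma eval_hom_Cst [simp]: "eval_hom h x (Cst c) = h c"
  by (simp add: Cst_def eval_hom_single)

lemma eval_hom_one [simp]: "eval_hom h x 1 = 1"
  using eval_hom_Cst[of x 1] by (simp add: Cst_def)

lemma eval_hom_Var [simp]: "eval_hom h x (Var y) = x y"
  by (cases y) (simp_all add: Var_def eval_hom_single lookup_single)

text \<open>Additivity in each factor reduces this to two monomials, where exponents add.\<close>

lemma eval_hom_mult [simp]: "eval_hom h x (f * g) = eval_hom h x f * eval_hom h x g"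
proof -
  have monomial: "eval_hom h x (Poly_Mapping.single d c * g) =
      eval_hom h x (Poly_Mapping.single d c) * eval_hom h x g" for d c
  proof (induction g rule: poly_single_induct)
    case (single e c')
    then show ?case
      by (simp add: mult_single eval_hom_single lookup_add power_add mult_ac)
  next
    case (sum f g)
    then show ?case by (simp add: distrib_left)
  qed
  show ?thesis
  proof (induction f rule: poly_single_induct)
    case (single e c')
    show ?case by (rule monomial)
  next
    case (sum f g)
    then show ?case by (simp add: distrib_right)
  qed
qed

lemma eval_hom_uminus [simp]: "eval_hom h x (- f) = - eval_hom h x f"
  using eval_hom_add[of x f "- f"] by (simp add: eq_neg_iff_add_eq_0 add.commute)

lemma eval_hom_diff [simp]: "eval_hom h x (f - g) = eval_hom h x f - eval_hom h x g"
  using eval_hom_add[of x f "- g"] by simp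

lemma eval_hom_power [simp]: "eval_hom h x (f ^ n) = eval_hom h x f ^ n"
  by (induction n) simp_all

end

lemma Cst_add: "Cst (a + b) = Cst a + Cst b"
  by (simp add: Cst_def single_add)

lemma Cst_mult: "Cst (a * b) = Cst a * Cst b"
  by (simp add: Cst_def mult_single)

lemma Cst_one [simp]: "Cst 1 = 1"
  by (simp add: Cst_def)

lemma Cst_0 [simp]: "Cst 0 = 0"
  by (simp add: Cst_def)

lemma Cst_uminus: "Cst (- a) = - Cst a"
  by (simp add: Cst_def single_uminus)

lemma Cst_diff: "Cst (a - b) = Cst a - Cst b"
  by (simp add: Cst_def single_diff)

lemma Cst_power: "Cst (a ^ n) = Cst a ^ n"
  by (induction n) (simp_all add: Cst_mult)

lemma Cst_numeral [simp]: "Cst (numeral n) = numeral n"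
  by (simp add: Cst_def)

lemma Cst_eq_0_iff [simp]: "Cst a = 0 \<longleftrightarrow> a = 0"
  by (metis Cst_0 Cst_def lookup_single_eq lookup_zero)

lemmas Cst_simps = Cst_add Cst_mult Cst_uminus Cst_diff Cst_power

interpretation eval_Cst: coeff_hom Cst
  by unfold_locales (simp_all add: Cst_simps)

interpretation eval_id: coeff_hom id
  by unfold_locales simp_all

lemma single_eq_monomial:
  "Poly_Mapping.single e c = Cst c * (Xs ^ Poly_Mapping.lookup e VS * Xt ^ Poly_Mapping.lookup e VT *
     Xu ^ Poly_Mapping.lookup e VU * Xv ^ Poly_Mapping.lookup e VV)"
proof -
  have pow: "Var x ^ n = (Poly_Mapping.single (Poly_Mapping.single x n) 1 :: 'a bigraded_poly)" for x n
    by (induction n) (simp_all add: Var_def mult_single flip: single_add)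
  have "e = Poly_Mapping.single VS (Poly_Mapping.lookup e VS) +
      Poly_Mapping.single VT (Poly_Mapping.lookup e VT) +
      Poly_Mapping.single VU (Poly_Mapping.lookup e VU) +
      Poly_Mapping.single VV (Poly_Mapping.lookup e VV)" (is "e = ?e")
  proof (rule poly_mapping_eqI)
    fix y show "Poly_Mapping.lookup e y = Poly_Mapping.lookup ?e y"
      by (cases y) (simp_all add: lookup_add lookup_single)
  qed
  then show ?thesis
    by (simp add: pow Cst_def mult_single)
qed

text \<open>Constants and variables generate the polynomial ring. The rule serves to compare ring
  homomorphisms, such as a reduction or a substitution followed by its inverse with the
  identity.\<close>

lemma bigraded_poly_induct [case_names Cst Var add mult]:
  assumes "\<And>c. P (Cst c)" "\<And>x. P (Var x)"
    and add: "\<And>f g. P f \<Longrightarrow> P g \<Longrightarrow> P (f + g)"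
    and mult: "\<And>f g. P f \<Longrightarrow> P g \<Longrightarrow> P (f * g)"
  shows "P f"
proof -
  have pow: "P (g ^ n)" if "P g" for g n
    by (induction n) (use that mult assms(1)[of 1] in auto)
  have "P (Poly_Mapping.single e c)" for e c
    unfolding single_eq_monomial by (intro mult pow assms)
  then show ?thesis
    by (induction f rule: poly_single_induct) (auto intro: add)
qed

section \<open>Reduction modulo a variable and primality\<close>

text \<open>The quotient map modulo \<open>Var x\<close>, realised as an endomorphism: each residue
  class is represented by its member free of that variable.\<close>

definition set_zero :: "var \<Rightarrow> 'k::comm_ring_1 bigraded_poly \<Rightarrow> 'k bigraded_poly" where
  "set_zero x = eval_hom Cst (Var(x := 0))"

lemma set_zero_simps [simp]:
  "set_zero x (f + g) = set_zero x f + set_zero x g"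
  "set_zero x (f * g) = set_zero x f * set_zero x g"
  "set_zero x (f - g) = set_zero x f - set_zero x g"
  "set_zero x (- f) = - set_zero x f"
  "set_zero x (f ^ n) = set_zero x f ^ n"
  "set_zero x 0 = 0"
  "set_zero x 1 = 1"
  "set_zero x (Cst c) = Cst c"
  "set_zero x (Var y) = (if x = y then 0 else Var y)"
  by (simp_all add: set_zero_def)

lemma Var_dvd_diff_set_zero: "Var x dvd f - set_zero x f"
proof (induction f rule: bigraded_poly_induct)
  case (add f g)
  then show ?case using dvd_add[OF add] by (simp add: add_diff_add)
next
  case (mult f g)
  have "f * g - set_zero x (f * g) = (f - set_zero x f) * g + set_zero x f * (g - set_zero x g)"
    by (simp add: algebra_simps)
  with mult show ?case by (metis dvd_add dvd_mult dvd_mult2)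
qed auto

lemma Var_dvd_iff: "Var x dvd f \<longleftrightarrow> set_zero x f = 0"
proof
  assume "set_zero x f = 0"
  with Var_dvd_diff_set_zero[of x f] show "Var x dvd f" by simp
qed auto

lemma set_zero_decomp: obtains g where "f = set_zero x f + Var x * g"
  using Var_dvd_diff_set_zero[of x f] by (auto elim!: dvdE simp: algebra_simps)

lemma Var_neq_0 [simp]: "Var x \<noteq> (0 :: 'k::comm_ring_1 bigraded_poly)"
proof
  assume "Var x = (0 :: 'k bigraded_poly)"
  then have "eval_hom Cst (\<lambda>_. 1) (Var x) = (0 :: 'k bigraded_poly)" by simp
  then show False by simp
qed

text \<open>\<open>set_zero x\<close> is multiplicative, has values in a domain, and its kernel
  consists of the multiples of \<open>Var x\<close>; so the variable is prime.\<close>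

lemma Var_dvd_mult_iff:
  fixes f g :: "'k::idom bigraded_poly"
  shows "Var x dvd f * g \<longleftrightarrow> Var x dvd f \<or> Var x dvd g"
  by (simp add: Var_dvd_iff)

lemma set_zero_lform [simp]:
  "set_zero VS (lform a b i) = lform a b i"
  "set_zero VT (lform a b i) = lform a b i"
  "set_zero VS (qform a b) = qform a b"
  "set_zero VT (qform a b) = qform a b"
  by (simp_all add: lform_def qform_def)

text \<open>Setting \<open>s\<close> or \<open>t\<close> to 0 turns the congruence into an equation,
  and \<open>v\<close> is a prime not dividing \<open>u\<close>, which leaves only the Koszul
  syzygy. The terms with \<open>m\<close> and \<open>n\<close> restore what the reduction
  dropped.\<close>

lemma uv_syzygy_mod:
  fixes X Y :: "'k::idom bigraded_poly"
  assumes x: "x = VS \<or> x = VT" and dvd: "Var x dvd Xu * X + Xv * Y"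
  obtains h m n where "X = Xv * h + Var x * m" "Y = - Xu * h + Var x * n"
proof -
  let ?X = "set_zero x X" and ?Y = "set_zero x Y"
  have eq: "Xu * ?X + Xv * ?Y = 0"
    using dvd x by (auto simp: Var_dvd_iff)
  then have "Xu * ?X = Xv * (- ?Y)" by (simp add: eq_neg_iff_add_eq_0)
  then have "Xv dvd Xu * ?X" by (rule dvdI)
  then have "Xv dvd ?X" by (simp add: Var_dvd_mult_iff) (simp add: Var_dvd_iff)
  then obtain h where h: "?X = Xv * h" by (elim dvdE)
  have "Xv * (Xu * h + ?Y) = 0" using eq unfolding h by (simp only: distrib_left mult.left_commute)
  then have h': "?Y = - Xu * h" by (simp add: eq_neg_iff_add_eq_0 add.commute)
  obtain m where m: "X = ?X + Var x * m" by (rule set_zero_decomp)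
  obtain n where n: "Y = ?Y + Var x * n" by (rule set_zero_decomp)
  from m n show ?thesis unfolding h h' by (rule that)
qed

lemma uv_syzygy:
  fixes X Y :: "'k::idom bigraded_poly"
  assumes eq: "Xu * X + Xv * Y = 0"
  obtains h where "X = Xv * h" "Y = - Xu * h"
proof -
  from eq have "Xu * X = Xv * (- Y)" by (simp add: eq_neg_iff_add_eq_0)
  then have "Xv dvd Xu * X" by (rule dvdI)
  then have "Xv dvd X" by (simp add: Var_dvd_mult_iff) (simp add: Var_dvd_iff)
  then obtain h where h: "X = Xv * h" by (elim dvdE)
  have "Xv * (Xu * h + Y) = 0" using eq unfolding h by (simp only: distrib_left mult.left_commute)
  then have "Y = - Xu * h" by (simp add: eq_neg_iff_add_eq_0 add.commute)
  with h that show ?thesis by blast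
qed

text \<open>A nonzero determinant makes the two forms an invertible linear change of
  \<open>u\<close>, \<open>v\<close>, so the Koszul syzygy is transported by Cramer's rule.\<close>

lemma lform_syzygy_mod:
  fixes f g :: "'k::field bigraded_poly"
  assumes x: "x = VS \<or> x = VT" and D: "a i * b j - a j * b i \<noteq> 0"
    and dvd: "Var x dvd lform a b i * f + lform a b j * g"
  obtains h m n where "f = - lform a b j * h + Var x * m" "g = lform a b i * h + Var x * n"
proof -
  define D where "D = a i * b j - a j * b i"
  \<comment> \<open>\<open>X\<close> and \<open>Y\<close> are the cofactors of \<open>u\<close> and
    \<open>v\<close> after expanding the two forms.\<close>
  define X where "X = Cst (a i) * f + Cst (a j) * g"
  define Y where "Y = Cst (b i) * f + Cst (b j) * g"
  have "Xu * X + Xv * Y = lform a b i * f + lform a b j * g"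
    by (simp add: X_def Y_def lform_def algebra_simps)
  with dvd have "Var x dvd Xu * X + Xv * Y" by simp
  then obtain h m n where hmn: "X = Xv * h + Var x * m" "Y = - Xu * h + Var x * n"
    by (rule uv_syzygy_mod[OF x])
  have inv: "Cst (1 / D) * Cst D = 1"
    using D by (simp add: D_def flip: Cst_mult)
  have "Cst D * f = Cst (b j) * X - Cst (a j) * Y"
       "Cst D * g = Cst (a i) * Y - Cst (b i) * X"
    by (simp_all add: D_def X_def Y_def Cst_simps algebra_simps)
  then have *: "Cst (1/D) * Cst D * f = Cst (1/D) * (Cst (b j) * X - Cst (a j) * Y)"
       "Cst (1/D) * Cst D * g = Cst (1/D) * (Cst (a i) * Y - Cst (b i) * X)"
    by (simp_all add: mult.assoc)
  show ?thesis
  proof (rule that)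
    show "f = - lform a b j * (- Cst (1/D) * h) + Var x * (Cst (1/D) * (Cst (b j) * m - Cst (a j) * n))"
      using * unfolding inv hmn by (simp add: lform_def algebra_simps)
    show "g = lform a b i * (- Cst (1/D) * h) + Var x * (Cst (1/D) * (Cst (a i) * n - Cst (b i) * m))"
      using * unfolding inv hmn by (simp add: lform_def algebra_simps)
  qed
qed

section \<open>Matrices given by rows\<close>

text \<open>Matrix times vector on lists: for literal rows, simplification produces the entries of
  the product without index arithmetic.\<close>

definition rows_apply :: "'a::comm_ring_1 list list \<Rightarrow> 'a list \<Rightarrow> 'a list" where
  "rows_apply Rs xs = map (\<lambda>r. sum_list (map2 (*) r xs)) Rs"

lemma rows_apply_Nil [simp]: "rows_apply [] xs = []"
  and rows_apply_Cons [simp]: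
    "rows_apply (r # Rs) xs = sum_list (map2 (*) r xs) # rows_apply Rs xs"
  and length_rows_apply [simp]: "length (rows_apply Rs xs) = length Rs"
  by (simp_all add: rows_apply_def)

lemma rows_apply_zero: "rows_apply Rs (replicate n 0) = replicate (length Rs) 0"
  by (simp add: rows_apply_def sum_list_sum_nth map_replicate_const)

lemma mat_of_rows_list_mult_vec_of_list:
  assumes "\<forall>r \<in> set Rs. length r = n" and "length xs = n"
  shows "mat_of_rows_list n Rs *\<^sub>v vec_of_list xs = vec_of_list (rows_apply Rs xs)"
proof (rule eq_vecI)
  fix i assume "i < dim_vec (vec_of_list (rows_apply Rs xs))"
  then have i: "i < length Rs" by simp
  then have len: "length (Rs ! i) = n" using assms by simp
  have "(mat_of_rows_list n Rs *\<^sub>v vec_of_list xs) $ i = (\<Sum>j<n. Rs ! i ! j * xs ! j)"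
    using i assms(2)
    by (simp add: mat_of_rows_list_def scalar_prod_def vec_of_list_index lessThan_atLeast0)
  also have "\<dots> = sum_list (map2 (*) (Rs ! i) xs)"
    using len assms(2) by (simp add: sum_list_sum_nth lessThan_atLeast0)
  finally show "(mat_of_rows_list n Rs *\<^sub>v vec_of_list xs) $ i =
      vec_of_list (rows_apply Rs xs) $ i"
    using i by (simp add: vec_of_list_index rows_apply_def)
qed (simp add: mat_of_rows_list_def)

lemma vec_of_list_eq_iff [simp]: "vec_of_list xs = vec_of_list ys \<longleftrightarrow> xs = ys"
  by (metis list_vec)

lemma carrier_vec_vec_of_list: "carrier_vec n = vec_of_list ` {xs. length xs = n}"
proof (rule Set.set_eqI, rule iffI)
  fix x :: "'a vec" assume "x \<in> carrier_vec n"
  then have "x = vec_of_list (list_of_vec x)" "length (list_of_vec x) = n"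
    by (simp_all only: vec_list length_list_of_vec carrier_vecD)
  then show "x \<in> vec_of_list ` {xs. length xs = n}" by blast
next
  fix x :: "'a vec" assume "x \<in> vec_of_list ` {xs. length xs = n}"
  then show "x \<in> carrier_vec n" by (elim imageE) (simp add: carrier_vecI)
qed

lemma zero_vec_vec_of_list: "0\<^sub>v n = vec_of_list (replicate n 0)"
proof (rule eq_vecI)
  fix i assume "i < dim_vec (vec_of_list (replicate n (0::'a)))"
  then have "i < n" by simp
  then show "0\<^sub>v n $ i = vec_of_list (replicate n (0::'a)) $ i"
    unfolding vec_of_list_index by simp
qed simp

lemma dim_mat_of_rows_list [simp]:
  "dim_row (mat_of_rows_list n Rs) = length Rs" "dim_col (mat_of_rows_list n Rs) = n"
  by (simp_all add: mat_of_rows_list_def)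

lemma mat_image_rows:
  assumes "\<forall>r \<in> set Rs. length r = n"
  shows "vec_of_list ys \<in> mat_image (mat_of_rows_list n Rs) \<longleftrightarrow>
    (\<exists>xs. length xs = n \<and> ys = rows_apply Rs xs)"
  using mat_of_rows_list_mult_vec_of_list[OF assms]
  by (auto simp: mat_image_def carrier_vec_vec_of_list image_image image_iff)

lemma mat_kernel_rows:
  assumes "\<forall>r \<in> set Rs. length r = n"
  shows "vec_of_list xs \<in> mat_kernel (mat_of_rows_list n Rs) \<longleftrightarrow>
    length xs = n \<and> rows_apply Rs xs = replicate (length Rs) 0"
  using mat_of_rows_list_mult_vec_of_list[OF assms, of xs]
  by (auto simp: mat_kernel_def carrier_vec_vec_of_list zero_vec_vec_of_list)

lemma vec_set_eqI:
  assumes "\<And>xs. vec_of_list xs \<in> A \<longleftrightarrow> vec_of_list xs \<in> B"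
  shows "A = B"
proof (rule Set.set_eqI)
  fix x show "x \<in> A \<longleftrightarrow> x \<in> B"
    using assms[of "list_of_vec x"] by (simp add: vec_list)
qed

section \<open>Bihomogeneous pieces and graded matrices\<close>

lemma piece_zero [simp, intro]: "0 \<in> piece m n"
  by (simp add: piece_def)

lemma piece_add [intro]: "f \<in> piece m n \<Longrightarrow> g \<in> piece m n \<Longrightarrow> f + g \<in> piece m n"
  using Poly_Mapping.keys_add[of f g] by (auto simp: piece_def)

lemma piece_uminus [intro]: "f \<in> piece m n \<Longrightarrow> - f \<in> piece m n"
  by (auto simp: piece_def in_keys_iff)

lemma piece_diff [intro]: "f \<in> piece m n \<Longrightarrow> g \<in> piece m n \<Longrightarrow> f - g \<in> piece m n"
  using piece_add[of f m n "- g"] by auto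

text \<open>The bidegree of the product is tied to those of the factors by equations, so that the
  rule applies backwards to goals with numeral bidegrees.\<close>

lemma piece_mult:
  assumes "f \<in> piece m n" "g \<in> piece m' n'" and "M = m + m'" "N = n + n'"
  shows "f * g \<in> piece M N"
  unfolding piece_def
proof (clarify)
  fix e assume "e \<in> Poly_Mapping.keys (f * g)"
  then obtain d d' where "e = d + d'" "d \<in> Poly_Mapping.keys f" "d' \<in> Poly_Mapping.keys g"
    using Poly_Mapping.keys_mult[of f g] by blast
  with assms show "int (Poly_Mapping.lookup e VS + Poly_Mapping.lookup e VT) = M \<and>
     int (Poly_Mapping.lookup e VU + Poly_Mapping.lookup e VV) = N"
    by (auto simp: piece_def lookup_add)
qed

lemma piece_Cst: "m = 0 \<Longrightarrow> n = 0 \<Longrightarrow> Cst c \<in> piece m n"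
  by (simp add: piece_def Cst_def)

lemma piece_Var:
  "m = (if x = VS \<or> x = VT then 1 else 0) \<Longrightarrow> n = (if x = VU \<or> x = VV then 1 else 0) \<Longrightarrow>
   Var x \<in> piece m n"
  by (cases x) (simp_all add: piece_def Var_def lookup_single)

lemma piece_power2: "f \<in> piece m n \<Longrightarrow> M = m + m \<Longrightarrow> N = n + n \<Longrightarrow> f\<^sup>2 \<in> piece M N"
  unfolding power2_eq_square by (rule piece_mult)

lemma piece_lform: "m = 0 \<Longrightarrow> n = 1 \<Longrightarrow> lform a b i \<in> piece m n"
  by (simp add: lform_def) (intro piece_add piece_mult[OF piece_Cst[OF refl refl] piece_Var[OF refl refl]]; simp)

lemmas piece_intros = piece_zero piece_add piece_uminus piece_diff piece_mult piece_Cst piece_Var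
  piece_power2 piece_lform

lemma piece_sum_list: "(\<And>f. f \<in> set fs \<Longrightarrow> f \<in> piece m n) \<Longrightarrow> sum_list fs \<in> piece m n"
  by (induction fs) auto

text \<open>An entry whose bidegree is the row twist minus the column twist carries the component
  for its column into the piece prescribed for its row.\<close>

lemma graded_map_rows:
  fixes Rs :: "'k::comm_ring_1 bigraded_poly list list"
  assumes n: "n = length d" and hom: "list_all2 (\<lambda>x r.
    list_all2 (\<lambda>y f. f \<in> piece (fst x - fst y) (snd x - snd y)) d r) e Rs"
  shows "graded_map (mat_of_rows_list n Rs) d e"
  unfolding graded_map_def
proof (intro conjI allI ballI)
  have len: "length Rs = length e" "\<forall>r \<in> set Rs. length r = n"
    using hom n by (auto simp: list_all2_conv_all_nth in_set_conv_nth)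
  then show "mat_of_rows_list n Rs \<in> carrier_mat (length e) (length d)"
    using n by (simp add: mat_of_rows_list_def)
  fix m n' and x :: "'k bigraded_poly vec"
  assume x: "x \<in> twist_piece d m n'"
  then obtain xs where xs: "x = vec_of_list xs" "length xs = length d"
    by (auto simp: twist_piece_def carrier_vec_vec_of_list)
  have "rows_apply Rs xs ! i \<in> piece (m + fst (e ! i)) (n' + snd (e ! i))" if i: "i < length e" for i
  proof -
    have li: "length (Rs ! i) = length d" using len i n by simp
    have "Rs ! i ! j * xs ! j \<in> piece (m + fst (e ! i)) (n' + snd (e ! i))" if j: "j < length d" for j
    proof (rule piece_mult)
      show "Rs ! i ! j \<in> piece (fst (e ! i) - fst (d ! j)) (snd (e ! i) - snd (d ! j))"
        using hom i j by (simp add: list_all2_conv_all_nth)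
      show "xs ! j \<in> piece (m + fst (d ! j)) (n' + snd (d ! j))"
        using x xs j by (simp add: twist_piece_def vec_of_list_index)
    qed auto
    then show ?thesis
      using i len xs(2) li
      by (auto simp: rows_apply_def in_set_conv_nth intro!: piece_sum_list)
  qed
  then show "mat_of_rows_list n Rs *\<^sub>v x \<in> twist_piece e m n'"
    using len xs n
    by (simp add: twist_piece_def mat_of_rows_list_mult_vec_of_list vec_of_list_index
        carrier_vec_vec_of_list)
qed

lemma length_Suc_conv_ex:
  "(\<exists>xs. length xs = Suc n \<and> P xs) \<longleftrightarrow> (\<exists>x xs. length xs = n \<and> P (x # xs))"
  by (metis length_Cons length_Suc_conv)

lemma ideal_gen_eq:
  "ideal_gen p = (\<lambda>xs. sum_list (map2 (*) p xs)) ` {xs. length xs = length p}"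
proof (induction p)
  case Nil
  then show ?case by auto
next
  case (Cons a p)
  have "x \<in> ideal_gen (a # p) \<longleftrightarrow> (\<exists>k ks. length ks = length p \<and> x = a * k + sum_list (map2 (*) p ks))" for x
    by (auto simp: rmod.span_breakdown_eq Cons.IH image_iff algebra_simps)
  then show ?case
    by (auto simp: image_iff length_Suc_conv_ex) (force simp: length_Suc_conv)
qed

text \<open>Each equality of kernel and image is split into the vanishing of a composite and the
  lifting of kernel elements, over lists of known length whose entries can be named. The image of
  the last map is the ideal by \<open>ideal_gen_eq\<close>.\<close>

lemma exact_resolution_rows:
  assumes len: "length d3 = 2" "length d2 = 5" "length d1 = length p"
      "\<forall>r \<in> set Rs3. length r = 2" "\<forall>r \<in> set Rs2. length r = 5"
      "length Rs3 = 5" "length Rs2 = length p"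
    and graded: "graded_map (mat_of_rows_list 2 Rs3) d3 d2" "graded_map (mat_of_rows_list 5 Rs2) d2 d1"
      "graded_map (mat_of_rows_list (length p) [p]) d1 [(0, 0)]"
    and inj: "\<And>xs. length xs = 2 \<Longrightarrow> rows_apply Rs3 xs = replicate 5 0 \<Longrightarrow> xs = replicate 2 0"
    and complex3: "\<And>xs. length xs = 2 \<Longrightarrow> rows_apply Rs2 (rows_apply Rs3 xs) = replicate (length p) 0"
    and exact3: "\<And>zs. length zs = 5 \<Longrightarrow> rows_apply Rs2 zs = replicate (length p) 0 \<Longrightarrow>
        \<exists>xs. length xs = 2 \<and> zs = rows_apply Rs3 xs"
    and complex2: "\<And>zs. length zs = 5 \<Longrightarrow> rows_apply [p] (rows_apply Rs2 zs) = [0]"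
    and exact2: "\<And>gs. length gs = length p \<Longrightarrow> rows_apply [p] gs = [0] \<Longrightarrow>
        \<exists>zs. length zs = 5 \<and> gs = rows_apply Rs2 zs"
  shows "exact_resolution p d3 d2 d1 (mat_of_rows_list 2 Rs3) (mat_of_rows_list 5 Rs2)"
proof -
  have "rows_apply Rs3 (replicate 2 0) = replicate 5 0"
    using len(6) by (simp only: rows_apply_zero)
  then have "mat_kernel (mat_of_rows_list 2 Rs3) = {0\<^sub>v (dim_col (mat_of_rows_list 2 Rs3))}"
    using len inj
    by (intro vec_set_eqI) (auto simp: mat_kernel_rows zero_vec_vec_of_list)
  moreover have "mat_kernel (mat_of_rows_list 5 Rs2) = mat_image (mat_of_rows_list 2 Rs3)"
    by (rule vec_set_eqI) (use len complex3 exact3 in \<open>auto simp: mat_kernel_rows mat_image_rows\<close>)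
  moreover have "mat_kernel (mat_of_rows_list (length p) [p]) = mat_image (mat_of_rows_list 5 Rs2)"
    by (rule vec_set_eqI)
      (use len complex2 exact2 in \<open>auto simp: mat_kernel_rows mat_image_rows simp del: rows_apply_Cons\<close>)
  moreover have "(\<lambda>y. y $ 0) ` mat_image (mat_of_rows_list (length p) [p]) = ideal_gen p"
    by (auto simp: mat_image_def ideal_gen_eq image_image carrier_vec_vec_of_list vec_of_list_index
        mat_of_rows_list_mult_vec_of_list)
  ultimately show ?thesis
    using graded by (simp add: exact_resolution_def Let_def)
qed

section \<open>Exactness of the two complexes\<close>

text \<open>Evaluation at \<open>(u, v) = (1, 0)\<close> and \<open>(0, 1)\<close> gives the outer
  coefficients; evaluation at \<open>(1, 1)\<close> gives the sum of all three and hence the middle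
  one.\<close>

lemma lform_mult_eqD:
  fixes a b :: "nat \<Rightarrow> 'k::field"
  assumes "qform a b = lform \<alpha> \<beta> 1 * lform \<alpha> \<beta> 2"
  shows "a 1 * a 4 - a 2 * a 3 = \<alpha> 1 * \<alpha> 2"
    and "a 1 * b 4 + b 1 * a 4 - a 2 * b 3 - b 2 * a 3 = \<alpha> 1 * \<beta> 2 + \<beta> 1 * \<alpha> 2"
    and "b 1 * b 4 - b 2 * b 3 = \<beta> 1 * \<beta> 2"
proof -
  have ev: "eval_hom id x (qform a b) = eval_hom id x (lform \<alpha> \<beta> 1 * lform \<alpha> \<beta> 2)" for x
    using assms by simp
  show u: "a 1 * a 4 - a 2 * a 3 = \<alpha> 1 * \<alpha> 2"
    using ev[of "\<lambda>y. if y = VU then 1 else 0"] by (simp add: qform_def lform_def)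
  show v: "b 1 * b 4 - b 2 * b 3 = \<beta> 1 * \<beta> 2"
    using ev[of "\<lambda>y. if y = VV then 1 else 0"] by (simp add: qform_def lform_def)
  have "(a 1 + b 1) * (a 4 + b 4) - (a 2 + b 2) * (a 3 + b 3) =
      (\<alpha> 1 + \<beta> 1) * (\<alpha> 2 + \<beta> 2)"
    using ev[of "\<lambda>y. 1"] by (simp add: qform_def lform_def)
  with u v show "a 1 * b 4 + b 1 * a 4 - a 2 * b 3 - b 2 * a 3 = \<alpha> 1 * \<beta> 2 + \<beta> 1 * \<alpha> 2"
    by Groebner_Basis.algebra
qed

lemma Var_dvd_lform_iff [simp]: "x = VS \<or> x = VT \<Longrightarrow> Var x dvd lform a b i \<longleftrightarrow> lform a b i = 0"
  "x = VS \<or> x = VT \<Longrightarrow> Var x dvd qform a b \<longleftrightarrow> qform a b = 0"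
  by (auto simp: Var_dvd_iff)

lemma not_Var_dvd_Var [simp]: "x \<noteq> y \<Longrightarrow> \<not> Var x dvd (Var y :: 'k::comm_ring_1 bigraded_poly)"
  by (simp add: Var_dvd_iff)

section \<open>Kernel of the second map\<close>

text \<open>These are rows three and four of \<open>phi2_case1\<close>, which do not involve the
  first coordinate. Modulo \<open>s\<close> row three forces \<open>s\<close> to divide
  \<open>z3\<close>; after cancelling one \<open>s\<close> it forces \<open>s\<close> to divide
  \<open>z2 + t y\<close>. The quotients \<open>x\<close>, \<open>y\<close> are the coordinates with
  respect to the columns of \<open>phi3_case1\<close>.\<close>

lemma case1_kernel_phi2:
  fixes a b :: "nat \<Rightarrow> 'k::field" and z2 z3 z4 z5 :: "'k bigraded_poly"
  assumes l4: "lform a b 4 \<noteq> 0"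
    and r3: "- (Xs * lform a b 4) * z2 + (Xs * lform a b 3 + Xt * lform a b 4) * z3 - Xs\<^sup>2 * z4 = 0"
    and r4: "Xs * lform a b 2 * z2 + (- (Xs * lform a b 1) - Xt * lform a b 2) * z3 - Xs\<^sup>2 * z5 = 0"
  obtains x y where "z2 = Xs * x - Xt * y" "z3 = - Xs * y"
    "z4 = - lform a b 4 * x - lform a b 3 * y" "z5 = lform a b 2 * x + lform a b 1 * y"
proof -
  have "Xt * lform a b 4 * z3 = Xs * (lform a b 4 * z2 - lform a b 3 * z3 + Xs * z4)"
    using r3 by Groebner_Basis.algebra
  then have "Xs dvd Xt * lform a b 4 * z3" by (rule dvdI)
  then have "Xs dvd z3" using l4 by (simp add: Var_dvd_mult_iff)
  then obtain y' where y': "z3 = Xs * y'" by (elim dvdE)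
  \<comment> \<open>The sign matches the entry \<open>- Xs\<close> of
    \<open>phi3_case1\<close>.\<close>
  define y where "y = - y'"
  have y: "z3 = - Xs * y" by (simp add: y' y_def)
  have "Xs * (lform a b 4 * (z2 + Xt * y) + Xs * (lform a b 3 * y + z4)) = 0"
    using r3 y by Groebner_Basis.algebra
  then have eq: "lform a b 4 * (z2 + Xt * y) + Xs * (lform a b 3 * y + z4) = 0" by simp
  then have "lform a b 4 * (z2 + Xt * y) = Xs * (- (lform a b 3 * y + z4))"
    by Groebner_Basis.algebra
  then have "Xs dvd lform a b 4 * (z2 + Xt * y)" by (rule dvdI)
  then have "Xs dvd z2 + Xt * y" using l4 by (simp add: Var_dvd_mult_iff)
  then obtain x where "z2 + Xt * y = Xs * x" by (elim dvdE)
  then have x: "z2 = Xs * x - Xt * y" by (simp add: algebra_simps)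
  have "Xs * (lform a b 4 * x + lform a b 3 * y + z4) = 0"
    using eq x by Groebner_Basis.algebra
  then have "z4 = - lform a b 4 * x - lform a b 3 * y"
    by simp Groebner_Basis.algebra
  moreover have "Xs * (Xs * (lform a b 2 * x + lform a b 1 * y - z5)) = 0"
    using r4 x y by Groebner_Basis.algebra
  then have "z5 = lform a b 2 * x + lform a b 1 * y" by simp
  ultimately show ?thesis using that x y by blast
qed

text \<open>Row three modulo \<open>t\<close> shows that \<open>t\<close> divides \<open>z2\<close>,
  and modulo \<open>s\<close> that \<open>s\<close> divides \<open>z3\<close>. Then
  \<open>s t\<close> cancels from both rows, which determine \<open>z4\<close> and
  \<open>z5\<close>.\<close>

lemma case2_kernel_phi2:
  fixes a b :: "nat \<Rightarrow> 'k::field" and z2 z3 z4 z5 :: "'k bigraded_poly"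
  assumes l: "lform a b 3 \<noteq> 0" "lform a b 4 \<noteq> 0"
    and r3: "- (Xs * lform a b 3) * z2 - Xt * lform a b 4 * z3 - Xs * Xt * z4 = 0"
    and r4: "Xs * lform a b 1 * z2 + Xt * lform a b 2 * z3 - Xs * Xt * z5 = 0"
  obtains x y where "z2 = Xt * y" "z3 = Xs * x"
    "z4 = - lform a b 4 * x - lform a b 3 * y" "z5 = lform a b 2 * x + lform a b 1 * y"
proof -
  have "Xs * lform a b 3 * z2 = Xt * (- lform a b 4 * z3 - Xs * z4)"
    using r3 by Groebner_Basis.algebra
  then have "Xt dvd Xs * lform a b 3 * z2" by (rule dvdI)
  then have "Xt dvd z2" using l by (simp add: Var_dvd_mult_iff)
  then obtain y where y: "z2 = Xt * y" by (elim dvdE)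
  have "Xt * lform a b 4 * z3 = Xs * (- lform a b 3 * z2 - Xt * z4)"
    using r3 by Groebner_Basis.algebra
  then have "Xs dvd Xt * lform a b 4 * z3" by (rule dvdI)
  then have "Xs dvd z3" using l by (simp add: Var_dvd_mult_iff)
  then obtain x where x: "z3 = Xs * x" by (elim dvdE)
  have "Xs * (Xt * (lform a b 4 * x + lform a b 3 * y + z4)) = 0"
    using r3 x y by Groebner_Basis.algebra
  then have "z4 = - lform a b 4 * x - lform a b 3 * y"
    by simp Groebner_Basis.algebra
  moreover have "Xs * (Xt * (lform a b 2 * x + lform a b 1 * y - z5)) = 0"
    using r4 x y by Groebner_Basis.algebra
  then have "z5 = lform a b 2 * x + lform a b 1 * y" by simp
  ultimately show ?thesis using that x y by blast
qed

section \<open>Syzygies of the four generators\<close>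

text \<open>\<open>k\<close>, \<open>h\<close>, \<open>m\<close>, \<open>n\<close> are the
  multipliers of columns two to five of \<open>phi2_case1\<close>, read in rows three and four. They
  are found by repeatedly reducing modulo \<open>s\<close> and cancelling a factor
  \<open>s\<close>.\<close>

lemma case1_syzygies:
  fixes a b :: "nat \<Rightarrow> 'k::field" and g0 g1 g2 g3 :: "'k bigraded_poly"
  assumes D: "a 2 * b 4 - a 4 * b 2 \<noteq> 0" and q: "qform a b \<noteq> 0"
    and eq: "Xs\<^sup>2 * (Xu * g0 + Xv * g1) + (Xs * Xt * lform a b 1 + Xt\<^sup>2 * lform a b 2) * g2 +
      (Xs * Xt * lform a b 3 + Xt\<^sup>2 * lform a b 4) * g3 = 0"
  obtains k h m n where
    "g2 = - Xs * lform a b 4 * k + (Xs * lform a b 3 + Xt * lform a b 4) * h - Xs\<^sup>2 * m"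
    "g3 = Xs * lform a b 2 * k - (Xs * lform a b 1 + Xt * lform a b 2) * h - Xs\<^sup>2 * n"
proof -
  let ?l = "lform a b"
  have "Xt\<^sup>2 * (?l 2 * g2 + ?l 4 * g3) =
      Xs * (- (Xs * (Xu * g0 + Xv * g1) + Xt * ?l 1 * g2 + Xt * ?l 3 * g3))"
    using eq by Groebner_Basis.algebra
  then have "Xs dvd Xt\<^sup>2 * (?l 2 * g2 + ?l 4 * g3)" by (rule dvdI)
  then have "Xs dvd ?l 2 * g2 + ?l 4 * g3" by (simp add: Var_dvd_mult_iff power2_eq_square)
  then obtain h m n where g2: "g2 = - ?l 4 * h + Xs * m" and g3: "g3 = ?l 2 * h + Xs * n"
    by (rule lform_syzygy_mod[OF disjI1[OF refl] D])
  \<comment> \<open>In the terms with \<open>h\<close> the multiples of \<open>t^2\<close> cancel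
    and \<open>- s t q h\<close> remains, so \<open>s\<close> can be divided out.\<close>
  have "Xs * (Xs * (Xu * g0 + Xv * g1) + Xt * (- qform a b * h + (Xs * ?l 1 + Xt * ?l 2) * m
      + (Xs * ?l 3 + Xt * ?l 4) * n)) = 0"
    using eq g2 g3 unfolding qform_def by Groebner_Basis.algebra
  then have eq2: "Xs * (Xu * g0 + Xv * g1) + Xt * (- qform a b * h + (Xs * ?l 1 + Xt * ?l 2) * m
      + (Xs * ?l 3 + Xt * ?l 4) * n) = 0" by simp
  \<comment> \<open>At \<open>s = 0\<close> the reduction of \<open>h\<close> times \<open>q\<close>
    is a multiple of \<open>t\<close>. Since \<open>q\<close> is nonzero and free of
    \<open>t\<close>, the variable \<open>t\<close> divides that reduction.\<close>
  from arg_cong[OF eq2, of "set_zero VS"]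
  have "qform a b * set_zero VS h = Xt * (?l 2 * set_zero VS m + ?l 4 * set_zero VS n)"
    by simp Groebner_Basis.algebra
  then have "Xt dvd qform a b * set_zero VS h" by (rule dvdI)
  then have "Xt dvd set_zero VS h" using q by (simp add: Var_dvd_mult_iff)
  then obtain h1 where "set_zero VS h = Xt * h1" by (elim dvdE)
  then obtain h2 where h: "h = Xt * h1 + Xs * h2" using set_zero_decomp[of h VS] by metis
  \<comment> \<open>\<open>h1\<close> is, up to sign, the multiplier of column three. The new
    remainders absorb \<open>s h2\<close> and the terms with \<open>l1\<close> and \<open>l3\<close>
    that this column introduces.\<close>
  define m' where "m' = m - ?l 4 * h2 + ?l 3 * h1"
  define n' where "n' = n + ?l 2 * h2 - ?l 1 * h1"
  have g2': "g2 = - (Xs * ?l 3 + Xt * ?l 4) * h1 + Xs * m'"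
    unfolding g2 h m'_def by Groebner_Basis.algebra
  have g3': "g3 = (Xs * ?l 1 + Xt * ?l 2) * h1 + Xs * n'"
    unfolding g3 h n'_def by Groebner_Basis.algebra
  have "Xs * (Xs * (Xu * g0 + Xv * g1) + Xt * (Xs * ?l 1 + Xt * ?l 2) * m' +
      Xt * (Xs * ?l 3 + Xt * ?l 4) * n') = 0"
    using eq g2' g3' by Groebner_Basis.algebra
  then have "Xs * (Xu * g0 + Xv * g1) + Xt * (Xs * ?l 1 + Xt * ?l 2) * m' +
      Xt * (Xs * ?l 3 + Xt * ?l 4) * n' = 0" by simp
  \<comment> \<open>The remainders form another syzygy of \<open>l2\<close>, \<open>l4\<close>
    modulo \<open>s\<close>: its Koszul multiplier belongs to column two, what is left over to
    columns four and five.\<close>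
  then have "Xt\<^sup>2 * (?l 2 * m' + ?l 4 * n') =
      Xs * (- (Xu * g0 + Xv * g1 + Xt * ?l 1 * m' + Xt * ?l 3 * n'))"
    by Groebner_Basis.algebra
  then have "Xs dvd Xt\<^sup>2 * (?l 2 * m' + ?l 4 * n')" by (rule dvdI)
  then have "Xs dvd ?l 2 * m' + ?l 4 * n'" by (simp add: Var_dvd_mult_iff power2_eq_square)
  then obtain k m'' n'' where m': "m' = - ?l 4 * k + Xs * m''" and n': "n' = ?l 2 * k + Xs * n''"
    by (rule lform_syzygy_mod[OF disjI1[OF refl] D])
  show ?thesis
  proof (rule that)
    show "g2 = - Xs * ?l 4 * k + (Xs * ?l 3 + Xt * ?l 4) * (- h1) - Xs\<^sup>2 * (- m'')"
      using g2' m' by Groebner_Basis.algebra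
    show "g3 = Xs * ?l 2 * k - (Xs * ?l 1 + Xt * ?l 2) * (- h1) - Xs\<^sup>2 * (- n'')"
      using g3' n' by Groebner_Basis.algebra
  qed
qed

text \<open>Modulo \<open>s\<close> the relation is one between \<open>l2\<close> and
  \<open>l4\<close>, which leads to column three; modulo \<open>t\<close> it is one between
  \<open>l1\<close> and \<open>l3\<close>, which leads to column two. That \<open>q\<close> is
  nonzero lets the first Koszul multiplier split into a multiple of \<open>s\<close> and a multiple
  of \<open>t\<close>.\<close>

lemma case2_syzygies:
  fixes a b :: "nat \<Rightarrow> 'k::field" and g0 g1 g2 g3 :: "'k bigraded_poly"
  assumes D1: "a 1 * b 3 - a 3 * b 1 \<noteq> 0" and D2: "a 2 * b 4 - a 4 * b 2 \<noteq> 0"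
    and q: "qform a b \<noteq> 0"
    and eq: "Xs * Xt * (Xu * g0 + Xv * g1) + (Xs\<^sup>2 * lform a b 1 + Xt\<^sup>2 * lform a b 2) * g2 +
      (Xs\<^sup>2 * lform a b 3 + Xt\<^sup>2 * lform a b 4) * g3 = 0"
  obtains k h m n where
    "g2 = - Xs * lform a b 3 * k - Xt * lform a b 4 * h - Xs * Xt * m"
    "g3 = Xs * lform a b 1 * k + Xt * lform a b 2 * h - Xs * Xt * n"
proof -
  let ?l = "lform a b"
  have "Xt\<^sup>2 * (?l 2 * g2 + ?l 4 * g3) =
      Xs * (- (Xt * (Xu * g0 + Xv * g1) + Xs * ?l 1 * g2 + Xs * ?l 3 * g3))"
    using eq by Groebner_Basis.algebra
  then have "Xs dvd Xt\<^sup>2 * (?l 2 * g2 + ?l 4 * g3)" by (rule dvdI)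
  then have "Xs dvd ?l 2 * g2 + ?l 4 * g3" by (simp add: Var_dvd_mult_iff power2_eq_square)
  then obtain h m n where g2: "g2 = - ?l 4 * h + Xs * m" and g3: "g3 = ?l 2 * h + Xs * n"
    by (rule lform_syzygy_mod[OF disjI1[OF refl] D2])
  \<comment> \<open>At \<open>t = 0\<close>, after cancelling \<open>s^2\<close>, \<open>q\<close>
    times the reduction of \<open>h\<close> is a multiple of \<open>s\<close>; hence
    \<open>s\<close> divides the reduction of \<open>h\<close>.\<close>
  from arg_cong[OF eq, of "set_zero VT"]
  have "Xs\<^sup>2 * ?l 1 * (- ?l 4 * set_zero VT h + Xs * set_zero VT m) +
      Xs\<^sup>2 * ?l 3 * (?l 2 * set_zero VT h + Xs * set_zero VT n) = 0"
    by (simp add: g2 g3)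
  then have "Xs\<^sup>2 * (Xs * (?l 1 * set_zero VT m + ?l 3 * set_zero VT n) - qform a b * set_zero VT h) = 0"
    unfolding qform_def by Groebner_Basis.algebra
  then have "qform a b * set_zero VT h = Xs * (?l 1 * set_zero VT m + ?l 3 * set_zero VT n)"
    by simp
  then have "Xs dvd qform a b * set_zero VT h" by (rule dvdI)
  then have "Xs dvd set_zero VT h" using q by (simp add: Var_dvd_mult_iff)
  then obtain h2 where "set_zero VT h = Xs * h2" by (elim dvdE)
  then obtain h1 where h: "h = Xs * h2 + Xt * h1" using set_zero_decomp[of h VT] by metis
  define m' where "m' = m - ?l 4 * h2"
  define n' where "n' = n + ?l 2 * h2"
  have g2': "g2 = - Xt * ?l 4 * h1 + Xs * m'"
    unfolding g2 h m'_def by Groebner_Basis.algebra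
  have g3': "g3 = Xt * ?l 2 * h1 + Xs * n'"
    unfolding g3 h n'_def by Groebner_Basis.algebra
  \<comment> \<open>Apart from the term with \<open>l1\<close> and \<open>l3\<close>, everything
    left after cancelling \<open>s\<close> is a multiple of \<open>t\<close>.\<close>
  have "Xs * (Xs\<^sup>2 * (?l 1 * m' + ?l 3 * n') +
      Xt * (Xu * g0 + Xv * g1 - Xs * qform a b * h1 + Xt * ?l 2 * m' + Xt * ?l 4 * n')) = 0"
    using eq g2' g3' unfolding qform_def by Groebner_Basis.algebra
  then have "Xs\<^sup>2 * (?l 1 * m' + ?l 3 * n') =
      Xt * (- (Xu * g0 + Xv * g1 - Xs * qform a b * h1 + Xt * ?l 2 * m' + Xt * ?l 4 * n'))"
    by simp Groebner_Basis.algebra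
  then have "Xt dvd Xs\<^sup>2 * (?l 1 * m' + ?l 3 * n')" by (rule dvdI)
  then have "Xt dvd ?l 1 * m' + ?l 3 * n'" by (simp add: Var_dvd_mult_iff power2_eq_square)
  then obtain k m'' n'' where m': "m' = - ?l 3 * k + Xt * m''" and n': "n' = ?l 1 * k + Xt * n''"
    by (rule lform_syzygy_mod[OF disjI2[OF refl] D1])
  show ?thesis
  proof (rule that)
    show "g2 = - Xs * ?l 3 * k - Xt * ?l 4 * h1 - Xs * Xt * (- m'')"
      using g2' m' by Groebner_Basis.algebra
    show "g3 = Xs * ?l 1 * k + Xt * ?l 2 * h1 - Xs * Xt * (- n'')"
      using g3' n' by Groebner_Basis.algebra
  qed
qed

section \<open>Assembling the two resolutions\<close>

lemma length_2_iff: "length xs = 2 \<longleftrightarrow> (\<exists>x y. xs = [x, y])"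
  by (auto simp: length_Suc_conv numeral_eq_Suc)

lemma length_4_iff: "length xs = 4 \<longleftrightarrow> (\<exists>x1 x2 x3 x4. xs = [x1, x2, x3, x4])"
  by (auto simp: length_Suc_conv numeral_eq_Suc)

lemma length_5_iff: "length xs = 5 \<longleftrightarrow> (\<exists>x1 x2 x3 x4 x5. xs = [x1, x2, x3, x4, x5])"
  by (auto simp: length_Suc_conv numeral_eq_Suc)

lemma replicate_numeral_simps:
  "replicate 5 x = [x, x, x, x, x]" "replicate 4 x = [x, x, x, x]" "replicate 2 x = [x, x]"
  by (simp_all add: numeral_eq_Suc)

text \<open>Injectivity is read off the triangular rows two and three of \<open>\<phi>3\<close>. The
  divisibility lemmas handle all of a kernel element except the coordinates governed by rows one and
  two of \<open>\<phi>2\<close>, and there cancelling \<open>v\<close> or the Koszul syzygy of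
  \<open>u\<close>, \<open>v\<close> finishes.\<close>

lemma exact_resolution_case1:
  fixes p :: "'k::field bigraded_poly list"
  assumes nf: "normal_form1 a b \<alpha> \<beta> p"
    and D: "a 2 * b 4 - a 4 * b 2 \<noteq> 0" and q: "qform a b \<noteq> 0" and l4: "lform a b 4 \<noteq> 0"
  shows "exact_resolution p
          [(-4, -2), (-4, -2)]
          [(-2, -2), (-3, -2), (-3, -2), (-4, -1), (-4, -1)]
          [(-2, -1), (-2, -1), (-2, -1), (-2, -1)]
          (phi3_case1 a b \<alpha> \<beta>) (phi2_case1 a b \<alpha> \<beta>)"
proof -
  let ?l = "lform a b"
  define A12 where "A12 = Cst (a 1) * Xs * Xt + Cst (a 2) * Xt\<^sup>2"
  define A34 where "A34 = Cst (a 3) * Xs * Xt + Cst (a 4) * Xt\<^sup>2"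
  define B12 where "B12 = Cst (b 1) * Xs * Xt + Cst (b 2) * Xt\<^sup>2"
  define B34 where "B34 = Cst (b 3) * Xs * Xt + Cst (b 4) * Xt\<^sup>2"
  define \<gamma> where "\<gamma> = - (Cst (\<alpha> 1 * \<beta> 2) * Xs * Xt) + A12 * Cst (b 4) - A34 * Cst (b 2)"
  define \<delta> where "\<delta> = Cst (\<alpha> 1 * \<beta> 2) * Xt\<^sup>2 + A12 * Cst (b 3) - A34 * Cst (b 1)"
  define L2 where "L2 = lform \<alpha> \<beta> 2"
  define Rs2 where "Rs2 = [[Xv, Cst (\<alpha> 1) * Xt * L2, 0, A12, A34],
    [- Xu, Cst (\<beta> 1) * Xt * L2, 0, B12, B34],
    [0, - (Xs * ?l 4), Xs * ?l 3 + Xt * ?l 4, - (Xs\<^sup>2), 0],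
    [0, Xs * ?l 2, - (Xs * ?l 1) - Xt * ?l 2, 0, - (Xs\<^sup>2)]]"
  define Rs3 where "Rs3 = [[\<gamma>, \<delta>], [Xs, - Xt], [0, - Xs], [- ?l 4, - ?l 3], [?l 2, ?l 1]]"
  have p: "p = [Xs\<^sup>2 * Xu, Xs\<^sup>2 * Xv, Xs * Xt * ?l 1 + Xt\<^sup>2 * ?l 2, Xs * Xt * ?l 3 + Xt\<^sup>2 * ?l 4]"
    using nf by (simp add: normal_form1_def)
  \<comment> \<open>The coefficient identities of \<open>q = L1 L2\<close>, lifted to the ring; they
    are what makes the entries \<open>\<gamma>\<close> and \<open>\<delta>\<close> compatible with
    \<open>\<phi>2\<close>.\<close>
  have c: "Cst (a 1) * Cst (a 4) - Cst (a 2) * Cst (a 3) = Cst (\<alpha> 1) * Cst (\<alpha> 2)"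
    "Cst (a 1) * Cst (b 4) + Cst (b 1) * Cst (a 4) - Cst (a 2) * Cst (b 3) - Cst (b 2) * Cst (a 3) =
      Cst (\<alpha> 1) * Cst (\<beta> 2) + Cst (\<beta> 1) * Cst (\<alpha> 2)"
    "Cst (b 1) * Cst (b 4) - Cst (b 2) * Cst (b 3) = Cst (\<beta> 1) * Cst (\<beta> 2)"
    using nf lform_mult_eqD[of a b \<alpha> \<beta>] by (simp_all add: normal_form1_def flip: Cst_simps)
  have qL: "?l 1 * ?l 4 - ?l 2 * ?l 3 = (Cst (\<alpha> 1) * Xu + Cst (\<beta> 1) * Xv) * L2"
    using nf by (simp add: normal_form1_def qform_def L2_def lform_def)
  \<comment> \<open>Rows one and two of \<open>\<phi>2\<close> times the two columns of
    \<open>\<phi>3\<close>.\<close>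
  have u\<gamma>: "Xv * \<gamma> + Cst (\<alpha> 1) * Xt * L2 * Xs - A12 * ?l 4 + A34 * ?l 2 = 0"
    using c unfolding \<gamma>_def A12_def A34_def L2_def lform_def Cst_simps by Groebner_Basis.algebra
  have u\<delta>: "Xv * \<delta> - Cst (\<alpha> 1) * Xt * L2 * Xt - A12 * ?l 3 + A34 * ?l 1 = 0"
    using c unfolding \<delta>_def A12_def A34_def L2_def lform_def Cst_simps by Groebner_Basis.algebra
  have v\<gamma>: "- Xu * \<gamma> + Cst (\<beta> 1) * Xt * L2 * Xs - B12 * ?l 4 + B34 * ?l 2 = 0"
    using c unfolding \<gamma>_def A12_def A34_def B12_def B34_def L2_def lform_def Cst_simps by Groebner_Basis.algebra
  have v\<delta>: "- Xu * \<delta> - Cst (\<beta> 1) * Xt * L2 * Xt - B12 * ?l 3 + B34 * ?l 1 = 0"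
    using c unfolding \<delta>_def A12_def A34_def B12_def B34_def L2_def lform_def Cst_simps by Groebner_Basis.algebra
  \<comment> \<open>These make columns four and five of \<open>\<phi>2\<close> relations:
    \<open>s^2\<close> times the third or fourth generator is a combination of \<open>s^2 u\<close>
    and \<open>s^2 v\<close>.\<close>
  have p2: "Xu * A12 + Xv * B12 = Xs * Xt * ?l 1 + Xt\<^sup>2 * ?l 2"
    and p3: "Xu * A34 + Xv * B34 = Xs * Xt * ?l 3 + Xt\<^sup>2 * ?l 4"
    unfolding A12_def A34_def B12_def B34_def lform_def by Groebner_Basis.algebra+
  have phi2: "phi2_case1 a b \<alpha> \<beta> = mat_of_rows_list 5 Rs2"
    by (simp add: phi2_case1_def Rs2_def A12_def A34_def B12_def B34_def L2_def Let_def)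
  have phi3: "phi3_case1 a b \<alpha> \<beta> = mat_of_rows_list 2 Rs3"
    by (simp add: phi3_case1_def Rs3_def A12_def A34_def \<gamma>_def \<delta>_def Let_def)
  have rows2: "rows_apply Rs2 [z1, z2, z3, z4, z5] =
      [Xv * z1 + Cst (\<alpha> 1) * Xt * L2 * z2 + A12 * z4 + A34 * z5,
       - Xu * z1 + Cst (\<beta> 1) * Xt * L2 * z2 + B12 * z4 + B34 * z5,
       - (Xs * ?l 4) * z2 + (Xs * ?l 3 + Xt * ?l 4) * z3 - Xs\<^sup>2 * z4,
       Xs * ?l 2 * z2 + (- (Xs * ?l 1) - Xt * ?l 2) * z3 - Xs\<^sup>2 * z5]" for z1 z2 z3 z4 z5
    by (simp add: Rs2_def)
  have rows3: "rows_apply Rs3 [x, y] = [\<gamma> * x + \<delta> * y, Xs * x - Xt * y, - Xs * y,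
      - ?l 4 * x - ?l 3 * y, ?l 2 * x + ?l 1 * y]" for x y
    by (simp add: Rs3_def)
  show ?thesis
    unfolding phi2 phi3
  proof (rule exact_resolution_rows)
    show "graded_map (mat_of_rows_list 2 Rs3) [(-4, -2), (-4, -2)]
          [(-2, -2), (-3, -2), (-3, -2), (-4, -1), (-4, -1)]"
      by (rule graded_map_rows, simp)
        (simp add: Rs3_def \<gamma>_def \<delta>_def A12_def A34_def, intro conjI, (rule refl | rule piece_intros | simp)+)
    show "graded_map (mat_of_rows_list 5 Rs2)
          [(-2, -2), (-3, -2), (-3, -2), (-4, -1), (-4, -1)]
          [(-2, -1), (-2, -1), (-2, -1), (-2, -1)]"
      by (rule graded_map_rows, simp)
        (simp add: Rs2_def L2_def A12_def A34_def B12_def B34_def, intro conjI, (rule refl | rule piece_intros | simp)+)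
    show "graded_map (mat_of_rows_list (length p) [p]) [(-2, -1), (-2, -1), (-2, -1), (-2, -1)] [(0, 0)]"
      by (rule graded_map_rows, simp add: p)
        (simp add: p, intro conjI, (rule refl | rule piece_intros | simp)+)
  next
    fix xs assume "length xs = 2" "rows_apply Rs3 xs = replicate 5 0"
    then show "xs = replicate 2 0"
      by (auto simp: length_2_iff Rs3_def replicate_numeral_simps)
  next
    fix xs :: "'k bigraded_poly list" assume "length xs = 2"
    then obtain x y where xs: "xs = [x, y]" by (auto simp: length_2_iff)
    have "Xv * (\<gamma> * x + \<delta> * y) + Cst (\<alpha> 1) * Xt * L2 * (Xs * x - Xt * y) +
        A12 * (- ?l 4 * x - ?l 3 * y) + A34 * (?l 2 * x + ?l 1 * y) = 0"
      using u\<gamma> u\<delta> by Groebner_Basis.algebra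
    moreover have "- Xu * (\<gamma> * x + \<delta> * y) + Cst (\<beta> 1) * Xt * L2 * (Xs * x - Xt * y) +
        B12 * (- ?l 4 * x - ?l 3 * y) + B34 * (?l 2 * x + ?l 1 * y) = 0"
      using v\<gamma> v\<delta> by Groebner_Basis.algebra
    moreover have "- (Xs * ?l 4) * (Xs * x - Xt * y) + (Xs * ?l 3 + Xt * ?l 4) * (- Xs * y) -
        Xs\<^sup>2 * (- ?l 4 * x - ?l 3 * y) = 0"
      "Xs * ?l 2 * (Xs * x - Xt * y) + (- (Xs * ?l 1) - Xt * ?l 2) * (- Xs * y) -
        Xs\<^sup>2 * (?l 2 * x + ?l 1 * y) = 0"
      by Groebner_Basis.algebra+
    ultimately have "rows_apply Rs2 (rows_apply Rs3 xs) = [0, 0, 0, 0]"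
      by (simp only: xs rows3 rows2)
    then show "rows_apply Rs2 (rows_apply Rs3 xs) = replicate (length p) 0"
      by (simp add: p)
  next
    fix zs :: "'k bigraded_poly list"
    assume "length zs = 5" "rows_apply Rs2 zs = replicate (length p) 0"
    then obtain z1 z2 z3 z4 z5 where zs: "zs = [z1, z2, z3, z4, z5]"
      and r1: "Xv * z1 + Cst (\<alpha> 1) * Xt * L2 * z2 + A12 * z4 + A34 * z5 = 0"
      and r3: "- (Xs * ?l 4) * z2 + (Xs * ?l 3 + Xt * ?l 4) * z3 - Xs\<^sup>2 * z4 = 0"
      and r4: "Xs * ?l 2 * z2 + (- (Xs * ?l 1) - Xt * ?l 2) * z3 - Xs\<^sup>2 * z5 = 0"
      by (auto simp: length_5_iff p rows2)
    from case1_kernel_phi2[OF l4 r3 r4] obtain x y where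
      z: "z2 = Xs * x - Xt * y" "z3 = - Xs * y"
        "z4 = - ?l 4 * x - ?l 3 * y" "z5 = ?l 2 * x + ?l 1 * y" .
    \<comment> \<open>Row one fixes \<open>z1\<close>, because \<open>v\<close> can be
      cancelled.\<close>
    have "Xv * (z1 - (\<gamma> * x + \<delta> * y)) = 0"
      using r1 u\<gamma> u\<delta> unfolding z by Groebner_Basis.algebra
    then have "z1 = \<gamma> * x + \<delta> * y" by simp
    then show "\<exists>xs. length xs = 2 \<and> zs = rows_apply Rs3 xs"
      by (intro exI[of _ "[x, y]"]) (simp add: zs z rows3)
  next
    fix zs :: "'k bigraded_poly list"
    assume "length zs = 5"
    then obtain z1 z2 z3 z4 z5 where zs: "zs = [z1, z2, z3, z4, z5]" by (auto simp: length_5_iff)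
    show "rows_apply [p] (rows_apply Rs2 zs) = [0]"
      using qL p2 p3 by (simp add: zs p rows2) Groebner_Basis.algebra
  next
    fix gs :: "'k bigraded_poly list"
    assume "length gs = length p" and gs0: "rows_apply [p] gs = [0]"
    then have "length gs = 4" by (simp add: p)
    then obtain g0 g1 g2 g3 where gs: "gs = [g0, g1, g2, g3]" by (auto simp: length_4_iff)
    have eq: "Xs\<^sup>2 * (Xu * g0 + Xv * g1) + (Xs * Xt * ?l 1 + Xt\<^sup>2 * ?l 2) * g2 +
      (Xs * Xt * ?l 3 + Xt\<^sup>2 * ?l 4) * g3 = 0"
      using gs0 by (simp add: gs p algebra_simps)
    from case1_syzygies[OF D q eq] obtain k h m n where
      g: "g2 = - Xs * ?l 4 * k + (Xs * ?l 3 + Xt * ?l 4) * h - Xs\<^sup>2 * m"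
         "g3 = Xs * ?l 2 * k - (Xs * ?l 1 + Xt * ?l 2) * h - Xs\<^sup>2 * n" .
    \<comment> \<open>Once columns two to five are subtracted, the first two components form a
      syzygy of \<open>u\<close>, \<open>v\<close>, that is, a multiple of column one.\<close>
    have "Xs * (Xs * (Xu * (g0 - (Cst (\<alpha> 1) * Xt * L2 * k + A12 * m + A34 * n)) +
        Xv * (g1 - (Cst (\<beta> 1) * Xt * L2 * k + B12 * m + B34 * n)))) = 0"
      using eq g qL p2 p3 by Groebner_Basis.algebra
    then have "Xu * (g0 - (Cst (\<alpha> 1) * Xt * L2 * k + A12 * m + A34 * n)) +
        Xv * (g1 - (Cst (\<beta> 1) * Xt * L2 * k + B12 * m + B34 * n)) = 0" by simp
    then obtain j where "g0 - (Cst (\<alpha> 1) * Xt * L2 * k + A12 * m + A34 * n) = Xv * j"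
      "g1 - (Cst (\<beta> 1) * Xt * L2 * k + B12 * m + B34 * n) = - Xu * j" by (rule uv_syzygy)
    then have "g0 = Xv * j + Cst (\<alpha> 1) * Xt * L2 * k + A12 * m + A34 * n"
      "g1 = - Xu * j + Cst (\<beta> 1) * Xt * L2 * k + B12 * m + B34 * n"
      by Groebner_Basis.algebra+
    then show "\<exists>zs. length zs = 5 \<and> gs = rows_apply Rs2 zs"
      by (intro exI[of _ "[j, k, h, m, n]"]) (simp add: gs g rows2 algebra_simps)
  qed (simp_all add: p Rs2_def Rs3_def)
qed

text \<open>The scheme of Case 1 with \<open>s t\<close> in place of \<open>s^2\<close>; here
  columns two and three both rest on \<open>q = L1 L2\<close>.\<close>

lemma exact_resolution_case2:
  fixes p :: "'k::field bigraded_poly list"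
  assumes nf: "normal_form2 a b \<alpha> \<beta> p"
    and D1: "a 1 * b 3 - a 3 * b 1 \<noteq> 0" and D2: "a 2 * b 4 - a 4 * b 2 \<noteq> 0"
    and q: "qform a b \<noteq> 0" and l: "lform a b 3 \<noteq> 0" "lform a b 4 \<noteq> 0"
  shows "exact_resolution p
          [(-4, -2), (-4, -2)]
          [(-2, -2), (-3, -2), (-3, -2), (-4, -1), (-4, -1)]
          [(-2, -1), (-2, -1), (-2, -1), (-2, -1)]
          (phi3_case2 a b \<alpha> \<beta>) (phi2_case2 a b \<alpha> \<beta>)"
proof -
  let ?l = "lform a b"
  define A12 where "A12 = Cst (a 1) * Xs\<^sup>2 + Cst (a 2) * Xt\<^sup>2"
  define A34 where "A34 = Cst (a 3) * Xs\<^sup>2 + Cst (a 4) * Xt\<^sup>2"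
  define B12 where "B12 = Cst (b 1) * Xs\<^sup>2 + Cst (b 2) * Xt\<^sup>2"
  define B34 where "B34 = Cst (b 3) * Xs\<^sup>2 + Cst (b 4) * Xt\<^sup>2"
  define \<gamma> where "\<gamma> = Cst (- \<alpha> 1 * \<beta> 2 + a 1 * b 4 - a 3 * b 2) * Xs\<^sup>2 +
    Cst (a 2 * b 4 - a 4 * b 2) * Xt\<^sup>2"
  define \<delta> where "\<delta> = Cst (a 1 * b 3 - a 3 * b 1) * Xs\<^sup>2 +
    Cst (\<alpha> 1 * \<beta> 2 + a 2 * b 3 - a 4 * b 1) * Xt\<^sup>2"
  define L2 where "L2 = lform \<alpha> \<beta> 2"
  define Rs2 where "Rs2 = [[Xv, - (Cst (\<alpha> 1) * Xt * L2), Cst (\<alpha> 1) * Xs * L2, A12, A34],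
    [- Xu, - (Cst (\<beta> 1) * Xt * L2), Cst (\<beta> 1) * Xs * L2, B12, B34],
    [0, - (Xs * ?l 3), - (Xt * ?l 4), - (Xs * Xt), 0],
    [0, Xs * ?l 1, Xt * ?l 2, 0, - (Xs * Xt)]]"
  define Rs3 where "Rs3 = [[\<gamma>, \<delta>], [0, Xt], [Xs, 0], [- ?l 4, - ?l 3], [?l 2, ?l 1]]"
  have p: "p = [Xs * Xt * Xu, Xs * Xt * Xv, Xs\<^sup>2 * ?l 1 + Xt\<^sup>2 * ?l 2, Xs\<^sup>2 * ?l 3 + Xt\<^sup>2 * ?l 4]"
    using nf by (simp add: normal_form2_def)
  have c: "Cst (a 1) * Cst (a 4) - Cst (a 2) * Cst (a 3) = Cst (\<alpha> 1) * Cst (\<alpha> 2)"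
    "Cst (a 1) * Cst (b 4) + Cst (b 1) * Cst (a 4) - Cst (a 2) * Cst (b 3) - Cst (b 2) * Cst (a 3) =
      Cst (\<alpha> 1) * Cst (\<beta> 2) + Cst (\<beta> 1) * Cst (\<alpha> 2)"
    "Cst (b 1) * Cst (b 4) - Cst (b 2) * Cst (b 3) = Cst (\<beta> 1) * Cst (\<beta> 2)"
    using nf lform_mult_eqD[of a b \<alpha> \<beta>] by (simp_all add: normal_form2_def flip: Cst_simps)
  have qL: "?l 1 * ?l 4 - ?l 2 * ?l 3 = (Cst (\<alpha> 1) * Xu + Cst (\<beta> 1) * Xv) * L2"
    using nf by (simp add: normal_form2_def qform_def L2_def lform_def)
  have u\<gamma>: "Xv * \<gamma> + Cst (\<alpha> 1) * Xs * L2 * Xs - A12 * ?l 4 + A34 * ?l 2 = 0"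
    using c unfolding \<gamma>_def A12_def A34_def L2_def lform_def Cst_simps by Groebner_Basis.algebra
  have u\<delta>: "Xv * \<delta> - Cst (\<alpha> 1) * Xt * L2 * Xt - A12 * ?l 3 + A34 * ?l 1 = 0"
    using c unfolding \<delta>_def A12_def A34_def L2_def lform_def Cst_simps by Groebner_Basis.algebra
  have v\<gamma>: "- Xu * \<gamma> + Cst (\<beta> 1) * Xs * L2 * Xs - B12 * ?l 4 + B34 * ?l 2 = 0"
    using c unfolding \<gamma>_def B12_def B34_def L2_def lform_def Cst_simps by Groebner_Basis.algebra
  have v\<delta>: "- Xu * \<delta> - Cst (\<beta> 1) * Xt * L2 * Xt - B12 * ?l 3 + B34 * ?l 1 = 0"
    using c unfolding \<delta>_def B12_def B34_def L2_def lform_def Cst_simps by Groebner_Basis.algebra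
  have p2: "Xu * A12 + Xv * B12 = Xs\<^sup>2 * ?l 1 + Xt\<^sup>2 * ?l 2"
    and p3: "Xu * A34 + Xv * B34 = Xs\<^sup>2 * ?l 3 + Xt\<^sup>2 * ?l 4"
    unfolding A12_def A34_def B12_def B34_def lform_def by Groebner_Basis.algebra+
  have phi2: "phi2_case2 a b \<alpha> \<beta> = mat_of_rows_list 5 Rs2"
    by (simp add: phi2_case2_def Rs2_def A12_def A34_def B12_def B34_def L2_def Let_def)
  have phi3: "phi3_case2 a b \<alpha> \<beta> = mat_of_rows_list 2 Rs3"
    by (simp add: phi3_case2_def Rs3_def A12_def A34_def \<gamma>_def \<delta>_def Let_def)
  have rows2: "rows_apply Rs2 [z1, z2, z3, z4, z5] =
      [Xv * z1 - Cst (\<alpha> 1) * Xt * L2 * z2 + Cst (\<alpha> 1) * Xs * L2 * z3 + A12 * z4 + A34 * z5,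
       - Xu * z1 - Cst (\<beta> 1) * Xt * L2 * z2 + Cst (\<beta> 1) * Xs * L2 * z3 + B12 * z4 + B34 * z5,
       - (Xs * ?l 3) * z2 - Xt * ?l 4 * z3 - Xs * Xt * z4,
       Xs * ?l 1 * z2 + Xt * ?l 2 * z3 - Xs * Xt * z5]" for z1 z2 z3 z4 z5
    by (simp add: Rs2_def)
  have rows3: "rows_apply Rs3 [x, y] = [\<gamma> * x + \<delta> * y, Xt * y, Xs * x,
      - ?l 4 * x - ?l 3 * y, ?l 2 * x + ?l 1 * y]" for x y
    by (simp add: Rs3_def)
  show ?thesis
    unfolding phi2 phi3
  proof (rule exact_resolution_rows)
    show "graded_map (mat_of_rows_list 2 Rs3) [(-4, -2), (-4, -2)]
          [(-2, -2), (-3, -2), (-3, -2), (-4, -1), (-4, -1)]"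
      by (rule graded_map_rows, simp)
        (simp add: Rs3_def \<gamma>_def \<delta>_def, intro conjI, (rule refl | rule piece_intros | simp)+)
    show "graded_map (mat_of_rows_list 5 Rs2)
          [(-2, -2), (-3, -2), (-3, -2), (-4, -1), (-4, -1)]
          [(-2, -1), (-2, -1), (-2, -1), (-2, -1)]"
      by (rule graded_map_rows, simp)
        (simp add: Rs2_def L2_def A12_def A34_def B12_def B34_def, intro conjI, (rule refl | rule piece_intros | simp)+)
    show "graded_map (mat_of_rows_list (length p) [p]) [(-2, -1), (-2, -1), (-2, -1), (-2, -1)] [(0, 0)]"
      by (rule graded_map_rows, simp add: p)
        (simp add: p, intro conjI, (rule refl | rule piece_intros | simp)+)
  next
    fix xs assume "length xs = 2" "rows_apply Rs3 xs = replicate 5 0"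
    then show "xs = replicate 2 0"
      by (auto simp: length_2_iff Rs3_def replicate_numeral_simps)
  next
    fix xs :: "'k bigraded_poly list" assume "length xs = 2"
    then obtain x y where xs: "xs = [x, y]" by (auto simp: length_2_iff)
    have "Xv * (\<gamma> * x + \<delta> * y) - Cst (\<alpha> 1) * Xt * L2 * (Xt * y) +
        Cst (\<alpha> 1) * Xs * L2 * (Xs * x) +
        A12 * (- ?l 4 * x - ?l 3 * y) + A34 * (?l 2 * x + ?l 1 * y) = 0"
      using u\<gamma> u\<delta> by Groebner_Basis.algebra
    moreover have "- Xu * (\<gamma> * x + \<delta> * y) - Cst (\<beta> 1) * Xt * L2 * (Xt * y) +
        Cst (\<beta> 1) * Xs * L2 * (Xs * x) +
        B12 * (- ?l 4 * x - ?l 3 * y) + B34 * (?l 2 * x + ?l 1 * y) = 0"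
      using v\<gamma> v\<delta> by Groebner_Basis.algebra
    moreover have "- (Xs * ?l 3) * (Xt * y) - Xt * ?l 4 * (Xs * x) -
        Xs * Xt * (- ?l 4 * x - ?l 3 * y) = 0"
      "Xs * ?l 1 * (Xt * y) + Xt * ?l 2 * (Xs * x) - Xs * Xt * (?l 2 * x + ?l 1 * y) = 0"
      by Groebner_Basis.algebra+
    ultimately have "rows_apply Rs2 (rows_apply Rs3 xs) = [0, 0, 0, 0]"
      by (simp only: xs rows3 rows2)
    then show "rows_apply Rs2 (rows_apply Rs3 xs) = replicate (length p) 0"
      by (simp add: p)
  next
    fix zs :: "'k bigraded_poly list"
    assume "length zs = 5" "rows_apply Rs2 zs = replicate (length p) 0"
    then obtain z1 z2 z3 z4 z5 where zs: "zs = [z1, z2, z3, z4, z5]"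
      and r1: "Xv * z1 - Cst (\<alpha> 1) * Xt * L2 * z2 + Cst (\<alpha> 1) * Xs * L2 * z3 + A12 * z4 + A34 * z5 = 0"
      and r3: "- (Xs * ?l 3) * z2 - Xt * ?l 4 * z3 - Xs * Xt * z4 = 0"
      and r4: "Xs * ?l 1 * z2 + Xt * ?l 2 * z3 - Xs * Xt * z5 = 0"
      by (auto simp: length_5_iff p rows2)
    from case2_kernel_phi2[OF l r3 r4] obtain x y where
      z: "z2 = Xt * y" "z3 = Xs * x"
        "z4 = - ?l 4 * x - ?l 3 * y" "z5 = ?l 2 * x + ?l 1 * y" .
    have "Xv * (z1 - (\<gamma> * x + \<delta> * y)) = 0"
      using r1 u\<gamma> u\<delta> unfolding z by Groebner_Basis.algebra
    then have "z1 = \<gamma> * x + \<delta> * y" by simp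
    then show "\<exists>xs. length xs = 2 \<and> zs = rows_apply Rs3 xs"
      by (intro exI[of _ "[x, y]"]) (simp add: zs z rows3)
  next
    fix zs :: "'k bigraded_poly list"
    assume "length zs = 5"
    then obtain z1 z2 z3 z4 z5 where zs: "zs = [z1, z2, z3, z4, z5]" by (auto simp: length_5_iff)
    show "rows_apply [p] (rows_apply Rs2 zs) = [0]"
      using qL p2 p3 by (simp add: zs p rows2) Groebner_Basis.algebra
  next
    fix gs :: "'k bigraded_poly list"
    assume "length gs = length p" and gs0: "rows_apply [p] gs = [0]"
    then have "length gs = 4" by (simp add: p)
    then obtain g0 g1 g2 g3 where gs: "gs = [g0, g1, g2, g3]" by (auto simp: length_4_iff)
    have eq: "Xs * Xt * (Xu * g0 + Xv * g1) + (Xs\<^sup>2 * ?l 1 + Xt\<^sup>2 * ?l 2) * g2 +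
      (Xs\<^sup>2 * ?l 3 + Xt\<^sup>2 * ?l 4) * g3 = 0"
      using gs0 by (simp add: gs p algebra_simps)
    from case2_syzygies[OF D1 D2 q eq] obtain k h m n where
      g: "g2 = - Xs * ?l 3 * k - Xt * ?l 4 * h - Xs * Xt * m"
         "g3 = Xs * ?l 1 * k + Xt * ?l 2 * h - Xs * Xt * n" .
    have "Xs * (Xt * (Xu * (g0 - (- (Cst (\<alpha> 1) * Xt * L2) * k + Cst (\<alpha> 1) * Xs * L2 * h + A12 * m + A34 * n)) +
        Xv * (g1 - (- (Cst (\<beta> 1) * Xt * L2) * k + Cst (\<beta> 1) * Xs * L2 * h + B12 * m + B34 * n)))) = 0"
      using eq g qL p2 p3 by Groebner_Basis.algebra
    then have "Xu * (g0 - (- (Cst (\<alpha> 1) * Xt * L2) * k + Cst (\<alpha> 1) * Xs * L2 * h + A12 * m + A34 * n)) +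
        Xv * (g1 - (- (Cst (\<beta> 1) * Xt * L2) * k + Cst (\<beta> 1) * Xs * L2 * h + B12 * m + B34 * n)) = 0"
      by simp
    then obtain j where
      "g0 - (- (Cst (\<alpha> 1) * Xt * L2) * k + Cst (\<alpha> 1) * Xs * L2 * h + A12 * m + A34 * n) = Xv * j"
      "g1 - (- (Cst (\<beta> 1) * Xt * L2) * k + Cst (\<beta> 1) * Xs * L2 * h + B12 * m + B34 * n) = - Xu * j"
      by (rule uv_syzygy)
    then have "g0 = Xv * j - Cst (\<alpha> 1) * Xt * L2 * k + Cst (\<alpha> 1) * Xs * L2 * h + A12 * m + A34 * n"
      "g1 = - Xu * j - Cst (\<beta> 1) * Xt * L2 * k + Cst (\<beta> 1) * Xs * L2 * h + B12 * m + B34 * n"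
      by Groebner_Basis.algebra+
    then show "\<exists>zs. length zs = 5 \<and> gs = rows_apply Rs2 zs"
      by (intro exI[of _ "[j, k, h, m, n]"]) (simp add: gs g rows2 algebra_simps)
  qed (simp_all add: p Rs2_def Rs3_def)
qed

section \<open>Linear syzygies and nondegeneracy\<close>

lemma piece_induct [consumes 1, case_names zero add monomial]:
  assumes f: "f \<in> piece m n"
    and zero: "P 0" and add: "\<And>f g. P f \<Longrightarrow> P g \<Longrightarrow> P (f + g)"
    and monomial: "\<And>c i j k l. int (i + j) = m \<Longrightarrow> int (k + l) = n \<Longrightarrow>
      P (Cst c * (Xs ^ i * Xt ^ j * Xu ^ k * Xv ^ l))"
  shows "P f"
proof -
  have "P (\<Sum>e \<in> A. Poly_Mapping.single e (Poly_Mapping.lookup f e))"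
    if "finite A" "A \<subseteq> Poly_Mapping.keys f" for A
    using that
  proof (induction A)
    case (insert e A)
    then show ?case
      using f by (auto simp: single_eq_monomial piece_def intro!: add monomial)
  qed (simp add: zero)
  from this[OF finite_keys order_refl] show ?thesis
    by (subst poly_eq_sum_monomials)
qed

lemma piece_0_1E:
  assumes "f \<in> piece 0 1"
  obtains x y where "f = Cst x * Xu + Cst y * Xv"
proof -
  from assms have "\<exists>x y. f = Cst x * Xu + Cst y * Xv"
  proof (induction f rule: piece_induct)
    case zero
    show ?case by (intro exI[of _ 0]) simp
  next
    case (add f g)
    then obtain x y x' y' where "f = Cst x * Xu + Cst y * Xv" "g = Cst x' * Xu + Cst y' * Xv"
      by blast
    then have "f + g = Cst (x + x') * Xu + Cst (y + y') * Xv"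
      by (simp add: Cst_add algebra_simps)
    then show ?case by blast
  next
    case (monomial c i j k l)
    then have "i = 0" "j = 0" "k = 1 \<and> l = 0 \<or> k = 0 \<and> l = 1" by auto
    then have "Cst c * (Xs ^ i * Xt ^ j * Xu ^ k * Xv ^ l) = Cst (if k = 1 then c else 0) * Xu +
        Cst (if k = 1 then 0 else c) * Xv"
      by auto
    then show ?case by blast
  qed
  with that show ?thesis by blast
qed

lemma piece_2_1E:
  fixes f :: "'k::comm_ring_1 bigraded_poly"
  assumes "f \<in> piece 2 1"
  obtains c d :: "nat \<Rightarrow> 'k" where
    "f = Xs\<^sup>2 * lform c d 0 + Xs * Xt * lform c d 1 + Xt\<^sup>2 * lform c d 2"
proof -
  from assms have "\<exists>c d. f = Xs\<^sup>2 * lform c d 0 + Xs * Xt * lform c d 1 + Xt\<^sup>2 * lform c d 2"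
  proof (induction f rule: piece_induct)
    case zero
    show ?case by (intro exI[of _ "\<lambda>_. 0"]) (simp add: lform_def)
  next
    case (add f g)
    then obtain c d c' d' where
      "f = Xs\<^sup>2 * lform c d 0 + Xs * Xt * lform c d 1 + Xt\<^sup>2 * lform c d 2"
      "g = Xs\<^sup>2 * lform c' d' 0 + Xs * Xt * lform c' d' 1 + Xt\<^sup>2 * lform c' d' 2"
      by blast
    then show ?case
      by (intro exI[of _ "\<lambda>i. c i + c' i"] exI[of _ "\<lambda>i. d i + d' i"])
        (simp add: lform_def Cst_add algebra_simps)
  next
    case (monomial c i j k l)
    then have "i = 2 \<and> j = 0 \<or> i = 1 \<and> j = 1 \<or> i = 0 \<and> j = 2" "k = 1 \<and> l = 0 \<or> k = 0 \<and> l = 1"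
      by auto
    \<comment> \<open>The index of \<open>lform c d\<close> is the exponent of \<open>t\<close>, so
      the monomial is recorded at \<open>j\<close>.\<close>
    then show ?case
      by (intro exI[of _ "\<lambda>n. if n = j \<and> k = 1 then c else 0"]
          exI[of _ "\<lambda>n. if n = j \<and> k = 0 then c else 0"])
        (auto simp: lform_def algebra_simps)
  qed
  with that show ?thesis by blast
qed

lemma uv_form_eq_iff:
  "Cst x * Xu + Cst y * Xv = (Cst x' * Xu + Cst y' * Xv :: 'k::comm_ring_1 bigraded_poly) \<longleftrightarrow> x = x' \<and> y = y'"
proof
  assume eq: "Cst x * Xu + Cst y * Xv = (Cst x' * Xu + Cst y' * Xv :: 'k bigraded_poly)"
  show "x = x' \<and> y = y'"
    using arg_cong[OF eq, of "eval_hom id (\<lambda>z. if z = VU then 1 else 0)"]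
      arg_cong[OF eq, of "eval_hom id (\<lambda>z. if z = VV then 1 else 0)"] by simp
qed simp

section \<open>Coordinates in a basis and the linear syzygy\<close>

text \<open>Distinctness makes positions correspond bijectively to basis elements, so combinations
  can be indexed by position, as syzygy vectors are.\<close>

lemma is_basis_span:
  assumes "is_basis p U"
  shows "P \<in> U \<longleftrightarrow> (\<exists>x. P = (\<Sum>i<length p. Cst (x i) * p ! i))"
proof -
  have bij: "bij_betw ((!) p) {..<length p} (set p)"
    using assms by (simp add: is_basis_def bij_betw_nth)
  have "P \<in> U \<longleftrightarrow> (\<exists>u. P = (\<Sum>v\<in>set p. Cst (u v) * v))"
    using assms by (auto simp: is_basis_def kvec.span_finite)
  also have "\<dots> \<longleftrightarrow> (\<exists>x. P = (\<Sum>i<length p. Cst (x i) * p ! i))"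
  proof
    assume "\<exists>u. P = (\<Sum>v\<in>set p. Cst (u v) * v)"
    then obtain u where "P = (\<Sum>v\<in>set p. Cst (u v) * v)" ..
    then show "\<exists>x. P = (\<Sum>i<length p. Cst (x i) * p ! i)"
      by (intro exI[of _ "\<lambda>i. u (p ! i)"]) (simp add: sum.reindex_bij_betw[OF bij, symmetric])
  next
    assume "\<exists>x. P = (\<Sum>i<length p. Cst (x i) * p ! i)"
    then obtain x where x: "P = (\<Sum>i<length p. Cst (x i) * p ! i)" ..
    have "inv_into {..<length p} ((!) p) (p ! i) = i" if "i < length p" for i
      using bij_betw_inv_into_left[OF bij] that by simp
    with x show "\<exists>u. P = (\<Sum>v\<in>set p. Cst (u v) * v)"
      by (intro exI[of _ "\<lambda>v. x (inv_into {..<length p} ((!) p) v)"])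
        (simp add: sum.reindex_bij_betw[OF bij, symmetric])
  qed
  finally show ?thesis .
qed

lemma is_basis_independent:
  assumes p: "is_basis p U" and sum: "(\<Sum>i<length p. Cst (x i) * p ! i) = 0" and "i < length p"
  shows "x i = 0"
proof -
  have bij: "bij_betw ((!) p) {..<length p} (set p)"
    using p by (simp add: is_basis_def bij_betw_nth)
  define u where "u v = x (inv_into {..<length p} ((!) p) v)" for v
  have u: "u (p ! i) = x i" if "i < length p" for i
    using bij_betw_inv_into_left[OF bij] that by (simp add: u_def)
  have "(\<Sum>v\<in>set p. Cst (u v) * v) = 0"
    using sum by (simp add: sum.reindex_bij_betw[OF bij, symmetric] u)
  then have "u (p ! i) = 0"
    using p \<open>i < length p\<close> by (intro kvec.independentD[of "set p" "set p"]) (auto simp: is_basis_def)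
  with u \<open>i < length p\<close> show ?thesis by simp
qed

lemma is_basis_4_independent:
  assumes p: "is_basis [p0, p1, p2, p3] U"
    and sum: "Cst x0 * p0 + Cst x1 * p1 + Cst x2 * p2 + Cst x3 * p3 = 0"
  shows "x0 = 0 \<and> x1 = 0 \<and> x2 = 0 \<and> x3 = 0"
proof -
  let ?x = "(!) [x0, x1, x2, x3]"
  have "?x i = 0" if "i < 4" for i
    by (rule is_basis_independent[OF p])
      (use that sum in \<open>simp_all add: lessThan_Suc add_ac\<close>)
  from this[of 0] this[of 1] this[of 2] this[of 3] show ?thesis by simp
qed

text \<open>A syzygy of bidegree \<open>(0, 1)\<close> amounts to a pair \<open>P\<close>,
  \<open>Q\<close> in \<open>U\<close> with \<open>u P + v Q = 0\<close>. The last conclusion is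
  uniqueness in this language, with the zero pair included as \<open>c = 0\<close>.\<close>

lemma unique_syzygyE:
  fixes p :: "'k::field bigraded_poly list"
  assumes p: "is_basis p U" and U: "U \<subseteq> piece 2 1" and uniq: "unique_first_syzygy p 0 1"
  obtains B c0 c1 c2 where
    "B = Cst c0 * Xs\<^sup>2 + Cst c1 * Xs * Xt + Cst c2 * Xt\<^sup>2" "B \<noteq> 0" "B * Xu \<in> U" "B * Xv \<in> U"
    "\<forall>P\<in>U. \<forall>Q\<in>U. Xu * P + Xv * Q = 0 \<longrightarrow>
      (\<exists>c. P = Cst c * (B * Xv) \<and> Q = - (Cst c * (B * Xu)))"
proof -
  let ?n = "length p"
  obtain g where g: "first_syzygy p 0 1 g"
    and g_uniq: "\<And>h. first_syzygy p 0 1 h \<Longrightarrow> \<exists>c. c \<noteq> 0 \<and> h = Cst c \<cdot>\<^sub>v g"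
    using uniq by (auto simp: unique_first_syzygy_def)
  have "\<exists>x y. g $ i = Cst x * Xu + Cst y * Xv" if "i < ?n" for i
  proof -
    have "g $ i \<in> piece 0 1" using g that by (simp add: first_syzygy_def)
    then show ?thesis by (rule piece_0_1E) blast
  qed
  then have "\<forall>i. \<exists>x y. i < ?n \<longrightarrow> g $ i = Cst x * Xu + Cst y * Xv" by blast
  then obtain x y where xy: "\<And>i. i < ?n \<Longrightarrow> g $ i = Cst (x i) * Xu + Cst (y i) * Xv"
    unfolding choice_iff by blast
  define P0 where "P0 = (\<Sum>i<?n. Cst (x i) * p ! i)"
  define Q0 where "Q0 = (\<Sum>i<?n. Cst (y i) * p ! i)"
  have sum_uv: "(\<Sum>i<?n. (Cst (x i) * Xu + Cst (y i) * Xv) * p ! i) =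
      Xu * (\<Sum>i<?n. Cst (x i) * p ! i) + Xv * (\<Sum>i<?n. Cst (y i) * p ! i)" for x y
    unfolding sum_distrib_left sum.distrib[symmetric] by (intro sum.cong refl) Groebner_Basis.algebra
  have "Xu * P0 + Xv * Q0 = (\<Sum>i<?n. g $ i * p ! i)"
    unfolding P0_def Q0_def sum_uv[symmetric] by (simp add: xy)
  then have "Xu * P0 + Xv * Q0 = 0" using g by (simp add: first_syzygy_def)
  then obtain B where B: "P0 = Xv * B" "Q0 = - Xu * B" by (rule uv_syzygy)
  have P0_U: "P0 \<in> U" and Q0_U: "Q0 \<in> U"
    using is_basis_span[OF p] by (auto simp: P0_def Q0_def)
  have U_scale: "Cst c * f \<in> U" if "f \<in> U" for c f
    using p that kvec.span_scale by (auto simp: is_basis_def)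
  obtain c d where cd: "P0 = Xs\<^sup>2 * lform c d 0 + Xs * Xt * lform c d 1 + Xt\<^sup>2 * lform c d 2"
    using piece_2_1E P0_U U by blast
  \<comment> \<open>\<open>P0\<close> is a multiple of \<open>v\<close>, so its coefficients at
    \<open>u\<close> vanish; cancelling \<open>v\<close> exhibits \<open>B\<close> as a quadratic
    form in \<open>s\<close>, \<open>t\<close>.\<close>
  have "set_zero VV P0 = 0" by (simp add: B)
  then have "Xu * (Xs\<^sup>2 * Cst (c 0) + Xs * Xt * Cst (c 1) + Xt\<^sup>2 * Cst (c 2)) = 0"
    by (simp add: cd lform_def algebra_simps)
  then have c: "Xs\<^sup>2 * Cst (c 0) + Xs * Xt * Cst (c 1) + Xt\<^sup>2 * Cst (c 2) = 0" by simp
  have "Xv * (B - (Cst (d 0) * Xs\<^sup>2 + Cst (d 1) * Xs * Xt + Cst (d 2) * Xt\<^sup>2)) = 0"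
    using cd c B(1) unfolding lform_def by Groebner_Basis.algebra
  then have B_eq: "B = Cst (d 0) * Xs\<^sup>2 + Cst (d 1) * Xs * Xt + Cst (d 2) * Xt\<^sup>2" by simp
  \<comment> \<open>Otherwise linear independence of \<open>p\<close> would annihilate all
    coefficients of the nonzero syzygy \<open>g\<close>.\<close>
  have "B \<noteq> 0"
  proof
    assume "B = 0"
    then have "P0 = 0" "Q0 = 0" using B by simp_all
    then have "x i = 0" "y i = 0" if "i < ?n" for i
      using is_basis_independent[OF p _ that] by (auto simp: P0_def Q0_def)
    then have "g = 0\<^sub>v ?n" using g xy by (intro eq_vecI) (auto simp: first_syzygy_def)
    with g show False by (simp add: first_syzygy_def)
  qed
  show ?thesis
  proof (rule that[OF B_eq \<open>B \<noteq> 0\<close>])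
    show "B * Xu \<in> U" using U_scale[OF Q0_U, of "-1"] by (simp add: B Cst_uminus mult.commute)
    show "B * Xv \<in> U" using P0_U by (simp add: B mult.commute)
    show "\<forall>P\<in>U. \<forall>Q\<in>U. Xu * P + Xv * Q = 0 \<longrightarrow>
      (\<exists>c. P = Cst c * (B * Xv) \<and> Q = - (Cst c * (B * Xu)))"
    proof (intro ballI impI)
      fix P Q assume PQ: "P \<in> U" "Q \<in> U" "Xu * P + Xv * Q = 0"
      obtain x' where x': "P = (\<Sum>i<?n. Cst (x' i) * p ! i)"
        using PQ(1) is_basis_span[OF p, of P] by blast
      obtain y' where y': "Q = (\<Sum>i<?n. Cst (y' i) * p ! i)"
        using PQ(2) is_basis_span[OF p, of Q] by blast
      define h where "h = vec ?n (\<lambda>i. Cst (x' i) * Xu + Cst (y' i) * Xv)"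
      have h_sum: "(\<Sum>i<?n. h $ i * p ! i) = 0"
        using PQ(3) sum_uv[of x' y'] by (simp add: h_def x' y')
      \<comment> \<open>Uniqueness concerns nonzero vectors only; the zero vector is the multiple by
        0.\<close>
      have "\<exists>c. h = Cst c \<cdot>\<^sub>v g"
      proof (cases "h = 0\<^sub>v ?n")
        case True
        moreover have "dim_vec g = ?n" using g by (simp add: first_syzygy_def)
        ultimately have "h = Cst 0 \<cdot>\<^sub>v g" by (intro eq_vecI) simp_all
        then show ?thesis by blast
      next
        case False
        have "h $ i \<in> piece 0 1" if "i < ?n" for i
          using that by (simp add: h_def) (intro piece_add piece_mult[OF piece_Cst[OF refl refl] piece_Var[OF refl refl]]; simp)
        with False h_sum have "first_syzygy p 0 1 h"
          by (simp add: first_syzygy_def h_def)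
        with g_uniq show ?thesis by blast
      qed
      then obtain c where c: "h = Cst c \<cdot>\<^sub>v g" by blast
      have eq: "x' i = c * x i \<and> y' i = c * y i" if i: "i < ?n" for i
      proof -
        have "dim_vec g = ?n" using g by (simp add: first_syzygy_def)
        then have "h $ i = Cst c * g $ i" using i unfolding c by simp
        moreover have "h $ i = Cst (x' i) * Xu + Cst (y' i) * Xv" using i by (simp add: h_def)
        ultimately have "Cst (x' i) * Xu + Cst (y' i) * Xv = Cst (c * x i) * Xu + Cst (c * y i) * Xv"
          using xy[OF i] unfolding Cst_mult by Groebner_Basis.algebra
        then show ?thesis unfolding uv_form_eq_iff .
      qed
      have x_scale: "Cst (x' i) * p ! i = Cst c * (Cst (x i) * p ! i)"
        and y_scale: "Cst (y' i) * p ! i = Cst c * (Cst (y i) * p ! i)" if "i < ?n" for i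
        using eq[OF that] by (simp_all only: Cst_mult mult.assoc)
      have "P = Cst c * P0"
        unfolding x' P0_def sum_distrib_left by (intro sum.cong refl x_scale) simp
      moreover have "Q = Cst c * Q0"
        unfolding y' Q0_def sum_distrib_left by (intro sum.cong refl y_scale) simp
      ultimately have "P = Cst c * (B * Xv) \<and> Q = - (Cst c * (B * Xu))"
        unfolding B by (intro conjI) Groebner_Basis.algebra+
      then show "\<exists>c. P = Cst c * (B * Xv) \<and> Q = - (Cst c * (B * Xu))" ..
    qed
  qed
qed

text \<open>The equation is a linear syzygy, so \<open>a i\<close> times \<open>p2\<close> minus
  \<open>a j\<close> times \<open>p3\<close> is a scalar multiple of \<open>K v\<close>.
  Independence of the basis then makes \<open>a i\<close> and \<open>a j\<close> vanish.\<close>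

lemma syzygy_coeffs_eq_0:
  fixes p :: "'k::field bigraded_poly list"
  assumes p: "is_basis p U" and U: "U \<subseteq> piece 2 1" and uniq: "unique_first_syzygy p 0 1"
    and p': "is_basis [K * Xu, K * Xv, p2, p3] U" and "K \<noteq> 0"
    and eq: "lform a b i * p2 = lform a b j * p3"
  shows "a i * b j - a j * b i = 0"
proof -
  obtain B c0 c1 c2 where "B = Cst c0 * Xs\<^sup>2 + Cst c1 * Xs * Xt + Cst c2 * Xt\<^sup>2"
    and "B \<noteq> 0" "B * Xu \<in> U" "B * Xv \<in> U"
    and B_uniq: "\<forall>P\<in>U. \<forall>Q\<in>U. Xu * P + Xv * Q = 0 \<longrightarrow>
      (\<exists>c. P = Cst c * (B * Xv) \<and> Q = - (Cst c * (B * Xu)))"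
    by (rule unique_syzygyE[OF p U uniq])
  have "set [K * Xu, K * Xv, p2, p3] \<subseteq> U"
    using p' kvec.span_superset by (metis is_basis_def)
  then have in_U: "K * Xu \<in> U" "K * Xv \<in> U" "p2 \<in> U" "p3 \<in> U" by simp_all
  have U: "kvec.subspace U"
    using p kvec.subspace_span by (auto simp: is_basis_def)
  \<comment> \<open>\<open>K v\<close> and \<open>- K u\<close> solve the same equation, so
    uniqueness makes \<open>K\<close> a scalar multiple of \<open>B\<close>.\<close>
  obtain c where c: "K * Xv = Cst c * (B * Xv)"
  proof -
    have "\<exists>c. K * Xv = Cst c * (B * Xv) \<and> - (K * Xu) = - (Cst c * (B * Xu))"
    proof (rule B_uniq[rule_format])
      show "- (K * Xu) \<in> U"
        using in_U kvec.subspace_neg[OF U] by blast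
      show "K * Xv \<in> U" by (rule in_U)
      show "Xu * (K * Xv) + Xv * - (K * Xu) = 0" by Groebner_Basis.algebra
    qed
    with that show ?thesis by blast
  qed
  then have "Xv * (K - Cst c * B) = 0" by Groebner_Basis.algebra
  then have K: "K = Cst c * B" by simp
  with \<open>K \<noteq> 0\<close> have "c \<noteq> 0" by auto
  define P where "P = Cst (a i) * p2 - Cst (a j) * p3"
  define Q where "Q = Cst (b i) * p2 - Cst (b j) * p3"
  have "P \<in> U" "Q \<in> U"
    using U in_U by (auto simp: P_def Q_def intro!: kvec.subspace_diff kvec.subspace_scale)
  moreover have "Xu * P + Xv * Q = 0"
    using eq by (simp add: P_def Q_def lform_def algebra_simps)
  ultimately obtain d where P: "P = Cst d * (B * Xv)"
    using B_uniq by blast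
  have "Cst c * P = Cst d * (K * Xv)" unfolding P K by (simp add: algebra_simps)
  then have "Cst 0 * (K * Xu) + Cst (- d) * (K * Xv) + Cst (c * a i) * p2 + Cst (- (c * a j)) * p3 = 0"
    by (simp add: P_def Cst_simps algebra_simps)
  from is_basis_4_independent[OF p' this] \<open>c \<noteq> 0\<close> show ?thesis by simp
qed

section \<open>Base points and nondegeneracy\<close>

lemma eval_hom_span_eq_0:
  fixes S :: "'k::field bigraded_poly set"
  assumes "f \<in> kvec.span S" "\<And>g. g \<in> S \<Longrightarrow> eval_hom id x g = 0"
  shows "eval_hom id x f = 0"
proof -
  have "kvec.subspace {f. eval_hom id x f = 0}"
    by (auto simp: kvec.subspace_def)
  then show ?thesis
    using kvec.span_induct[OF assms(1), of "\<lambda>f. eval_hom id x f = 0"] assms(2) by blast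
qed

text \<open>Base points depend only on the span, so the hypothesis passes to adapted bases of
  \<open>U\<close>.\<close>

lemma basepoint_free_basis:
  assumes "is_basis p U" "basepoint_free p" "is_basis p' U"
  shows "basepoint_free p'"
proof -
  have "eval_hom id x f = 0" if "\<forall>f \<in> set p'. eval_hom id x f = 0" "f \<in> set p" for x f
    using that assms(1,3) kvec.span_base by (intro eval_hom_span_eq_0[of f "set p'"]) (auto simp: is_basis_def)
  with assms(2) show ?thesis unfolding basepoint_free_def by blast
qed

text \<open>A kernel vector of the singular matrix with rows \<open>(a, c)\<close> and
  \<open>(b, d)\<close>: a nonzero first row is killed by \<open>(c, - a)\<close>, and the
  determinant condition handles the second.\<close>

lemma common_zero:
  fixes a b c d :: "'k::field"
  assumes "a * d - b * c = 0"
  obtains u v where "(u, v) \<noteq> (0, 0)" "a * u + c * v = 0" "b * u + d * v = 0"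
proof (cases "(a, c) = (0, 0)")
  case True
  then show ?thesis
    using that[of "d" "- b"] that[of 1 0] by (cases "(b, d) = (0, 0)") auto
next
  case False
  then show ?thesis using that[of c "- a"] assms by (auto simp: algebra_simps)
qed

text \<open>Dependent forms share a zero on the second projective line; paired with
  \<open>(s0, t0)\<close> it would be a base point.\<close>

lemma lform_det_neq_0:
  fixes p :: "'k::field bigraded_poly list"
  assumes bpf: "basepoint_free p" and st: "(s0, t0) \<noteq> (0, 0)"
    and vanish: "\<And>x f. x VS = s0 \<Longrightarrow> x VT = t0 \<Longrightarrow> eval_hom id x (lform a b i) = 0 \<Longrightarrow>
      eval_hom id x (lform a b j) = 0 \<Longrightarrow> f \<in> set p \<Longrightarrow> eval_hom id x f = 0"
  shows "a i * b j - a j * b i \<noteq> 0"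
proof
  assume "a i * b j - a j * b i = 0"
  then obtain u v where uv: "(u, v) \<noteq> (0, 0)" "a i * u + b i * v = 0" "a j * u + b j * v = 0"
    by (rule common_zero)
  define x where "x = case_var s0 t0 u v"
  have "\<forall>f \<in> set p. eval_hom id x f = 0"
    using uv vanish[of x] by (simp add: x_def lform_def)
  moreover have "(x VS, x VT) \<noteq> (0, 0)" "(x VU, x VV) \<noteq> (0, 0)"
    using st uv(1) by (simp_all add: x_def)
  ultimately show False using bpf unfolding basepoint_free_def by blast
qed

text \<open>Stated for arbitrary independent linear forms \<open>\<sigma>\<close>,
  \<open>\<tau>\<close>, so that it covers \<open>s\<close>, \<open>t\<close> themselves and also
  the coordinates in which a normal form is constructed.\<close>

lemma case1_nondegenerate:
  fixes p :: "'k::field bigraded_poly list"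
  assumes p: "is_basis p U" and U: "U \<subseteq> piece 2 1" and bpf: "basepoint_free p"
    and uniq: "unique_first_syzygy p 0 1"
    and \<sigma>: "\<sigma> = Cst e1 * Xs + Cst f1 * Xt" and \<tau>: "\<tau> = Cst e2 * Xs + Cst f2 * Xt"
    and det: "e1 * f2 - e2 * f1 \<noteq> 0"
    and p': "is_basis [\<sigma>\<^sup>2 * Xu, \<sigma>\<^sup>2 * Xv, \<sigma> * \<tau> * lform a b 1 + \<tau>\<^sup>2 * lform a b 2,
      \<sigma> * \<tau> * lform a b 3 + \<tau>\<^sup>2 * lform a b 4] U"
  shows "a 2 * b 4 - a 4 * b 2 \<noteq> 0" "qform a b \<noteq> 0"
proof -
  have \<sigma>0: "\<sigma> \<noteq> 0"
  proof
    assume "\<sigma> = 0"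
    then have "eval_hom id (case_var 1 0 0 0) \<sigma> = 0" "eval_hom id (case_var 0 1 0 0) \<sigma> = 0"
      by simp_all
    with det show False by (simp add: \<sigma>)
  qed
  \<comment> \<open>\<open>(f1, - e1)\<close> is the zero of \<open>\<sigma>\<close>, where only the
    terms in \<open>\<tau>^2\<close> survive.\<close>
  show D: "a 2 * b 4 - a 4 * b 2 \<noteq> 0"
    by (rule lform_det_neq_0[of _ f1 "- e1", OF basepoint_free_basis[OF p bpf p']])
      (use det in \<open>auto simp: \<sigma>\<close>)
  show "qform a b \<noteq> 0"
  proof
    assume "qform a b = 0"
    then have "lform a b 4 * (\<sigma> * \<tau> * lform a b 1 + \<tau>\<^sup>2 * lform a b 2) =
      lform a b 2 * (\<sigma> * \<tau> * lform a b 3 + \<tau>\<^sup>2 * lform a b 4)"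
      unfolding qform_def by Groebner_Basis.algebra
    from syzygy_coeffs_eq_0[OF p U uniq p' _ this] \<sigma>0 D show False by (simp add: algebra_simps)
  qed
qed

text \<open>Two points of the first projective line are tested: the zero of \<open>\<tau>\<close>
  for the forms 1 and 3, the zero of \<open>\<sigma>\<close> for 2 and 4.\<close>

lemma case2_nondegenerate:
  fixes p :: "'k::field bigraded_poly list"
  assumes p: "is_basis p U" and U: "U \<subseteq> piece 2 1" and bpf: "basepoint_free p"
    and uniq: "unique_first_syzygy p 0 1"
    and \<sigma>: "\<sigma> = Cst e1 * Xs + Cst f1 * Xt" and \<tau>: "\<tau> = Cst e2 * Xs + Cst f2 * Xt"
    and det: "e1 * f2 - e2 * f1 \<noteq> 0"
    and p': "is_basis [\<sigma> * \<tau> * Xu, \<sigma> * \<tau> * Xv, \<sigma>\<^sup>2 * lform a b 1 + \<tau>\<^sup>2 * lform a b 2,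
      \<sigma>\<^sup>2 * lform a b 3 + \<tau>\<^sup>2 * lform a b 4] U"
  shows "a 1 * b 3 - a 3 * b 1 \<noteq> 0" "a 2 * b 4 - a 4 * b 2 \<noteq> 0" "qform a b \<noteq> 0"
proof -
  have \<sigma>\<tau>: "\<sigma> \<noteq> 0" "\<tau> \<noteq> 0"
  proof -
    have "eval_hom id (case_var 1 0 0 0) \<sigma> = e1" "eval_hom id (case_var 0 1 0 0) \<sigma> = f1"
      "eval_hom id (case_var 1 0 0 0) \<tau> = e2" "eval_hom id (case_var 0 1 0 0) \<tau> = f2"
      by (simp_all add: \<sigma> \<tau>)
    with det show "\<sigma> \<noteq> 0" "\<tau> \<noteq> 0" by auto
  qed
  show "a 1 * b 3 - a 3 * b 1 \<noteq> 0"
    by (rule lform_det_neq_0[of _ f2 "- e2", OF basepoint_free_basis[OF p bpf p']])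
      (use det in \<open>auto simp: \<tau>\<close>)
  show D: "a 2 * b 4 - a 4 * b 2 \<noteq> 0"
    by (rule lform_det_neq_0[of _ f1 "- e1", OF basepoint_free_basis[OF p bpf p']])
      (use det in \<open>auto simp: \<sigma>\<close>)
  show "qform a b \<noteq> 0"
  proof
    assume "qform a b = 0"
    then have "lform a b 4 * (\<sigma>\<^sup>2 * lform a b 1 + \<tau>\<^sup>2 * lform a b 2) =
      lform a b 2 * (\<sigma>\<^sup>2 * lform a b 3 + \<tau>\<^sup>2 * lform a b 4)"
      unfolding qform_def by Groebner_Basis.algebra
    from syzygy_coeffs_eq_0[OF p U uniq p' _ this] \<sigma>\<tau> D show False by (simp add: algebra_simps)
  qed
qed

text \<open>The equations say that \<open>c0 X^2 + c1 X Y + c2 Y^2\<close> is the product of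
  \<open>e1 X + f1 Y\<close> and \<open>e2 X + f2 Y\<close>. If \<open>c0\<close> is 0, then
  \<open>Y\<close> splits off; otherwise a root \<open>r\<close> of the dehomogenised form gives the
  factor \<open>X - r Y\<close>.\<close>

lemma quadratic_factors:
  fixes c0 c1 c2 :: "'k::alg_closed_field"
  obtains e1 f1 e2 f2 where "c0 = e1 * e2" "c1 = e1 * f2 + f1 * e2" "c2 = f1 * f2"
proof (cases "c0 = 0")
  case True
  then show ?thesis using that[of 0 c1 c2 1] by simp
next
  case False
  have "\<exists>x. poly [:c2, c1, c0:] x = 0"
    using False by (intro alg_closed_imp_poly_has_root) simp
  then obtain r where "c2 + r * (c1 + r * c0) = 0" by auto
  then have "c2 = - r * (c1 + r * c0)" by (simp add: eq_neg_iff_add_eq_0)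
  then show ?thesis using that[of 1 c0 "c1 + r * c0" "- r"] by simp
qed

lemma lform_factorization:
  fixes a b :: "nat \<Rightarrow> 'k::alg_closed_field"
  obtains \<alpha> \<beta> where "qform a b = lform \<alpha> \<beta> 1 * lform \<alpha> \<beta> 2"
proof -
  obtain e1 f1 e2 f2 where e: "a 1 * a 4 - a 2 * a 3 = e1 * e2"
    "a 1 * b 4 + b 1 * a 4 - a 2 * b 3 - b 2 * a 3 = e1 * f2 + f1 * e2" "b 1 * b 4 - b 2 * b 3 = f1 * f2"
    by (rule quadratic_factors)
  have "Cst (a 1) * Cst (a 4) - Cst (a 2) * Cst (a 3) = Cst e1 * Cst e2"
    "Cst (a 1) * Cst (b 4) + Cst (b 1) * Cst (a 4) - Cst (a 2) * Cst (b 3) - Cst (b 2) * Cst (a 3) =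
      Cst e1 * Cst f2 + Cst f1 * Cst e2"
    "Cst (b 1) * Cst (b 4) - Cst (b 2) * Cst (b 3) = Cst f1 * Cst f2"
    using e by (simp_all flip: Cst_simps)
  then have "qform a b = (Cst e1 * Xu + Cst f1 * Xv) * (Cst e2 * Xu + Cst f2 * Xv)"
    unfolding qform_def lform_def by Groebner_Basis.algebra
  then show ?thesis
    using that[of "\<lambda>i. if i = 1 then e1 else e2" "\<lambda>i. if i = 1 then f1 else f2"]
    by (simp add: lform_def)
qed

section \<open>Existence of a normal form\<close>

lemma is_basis_4_iff:
  fixes p0 :: "'k::field bigraded_poly"
  shows "is_basis [p0, p1, p2, p3] U \<longleftrightarrow>
    (\<forall>x0 x1 x2 x3. Cst x0 * p0 + Cst x1 * p1 + Cst x2 * p2 + Cst x3 * p3 = 0 \<longrightarrow>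
      x0 = 0 \<and> x1 = 0 \<and> x2 = 0 \<and> x3 = 0) \<and>
    (\<forall>P. P \<in> U \<longleftrightarrow> (\<exists>x0 x1 x2 x3. P = Cst x0 * p0 + Cst x1 * p1 + Cst x2 * p2 + Cst x3 * p3))"
    (is "?L \<longleftrightarrow> ?indep \<and> ?span")
proof
  assume L: ?L
  have "P \<in> U \<longleftrightarrow> (\<exists>x0 x1 x2 x3. P = Cst x0 * p0 + Cst x1 * p1 + Cst x2 * p2 + Cst x3 * p3)" for P
  proof
    assume "P \<in> U"
    then obtain x where "P = (\<Sum>i<length [p0, p1, p2, p3]. Cst (x i) * [p0, p1, p2, p3] ! i)"
      unfolding is_basis_span[OF L, of P] by (elim exE)
    then have "P = Cst (x 0) * p0 + Cst (x 1) * p1 + Cst (x 2) * p2 + Cst (x 3) * p3"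
      by (simp add: lessThan_Suc numeral_eq_Suc add_ac)
    then show "\<exists>x0 x1 x2 x3. P = Cst x0 * p0 + Cst x1 * p1 + Cst x2 * p2 + Cst x3 * p3" by blast
  next
    assume "\<exists>x0 x1 x2 x3. P = Cst x0 * p0 + Cst x1 * p1 + Cst x2 * p2 + Cst x3 * p3"
    then obtain x0 x1 x2 x3 where "P = Cst x0 * p0 + Cst x1 * p1 + Cst x2 * p2 + Cst x3 * p3" by blast
    then have "P = (\<Sum>i<length [p0, p1, p2, p3]. Cst ([x0, x1, x2, x3] ! i) * [p0, p1, p2, p3] ! i)"
      by (simp add: lessThan_Suc numeral_eq_Suc add_ac)
    then show "P \<in> U" unfolding is_basis_span[OF L, of P] by (intro exI)
  qed
  with is_basis_4_independent[OF L] show "?indep \<and> ?span" by blast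
next
  assume R: "?indep \<and> ?span"
  then have indep: "x0 = 0 \<and> x1 = 0 \<and> x2 = 0 \<and> x3 = 0"
    if "Cst x0 * p0 + Cst x1 * p1 + Cst x2 * p2 + Cst x3 * p3 = 0" for x0 x1 x2 x3
    using that by blast
  \<comment> \<open>Two equal entries would give a relation with coefficients 1 and -1.\<close>
  have dist: "distinct [p0, p1, p2, p3]"
    using indep[of 1 "-1" 0 0] indep[of 1 0 "-1" 0] indep[of 1 0 0 "-1"] indep[of 0 1 "-1" 0]
      indep[of 0 1 0 "-1"] indep[of 0 0 1 "-1"] by (auto simp: Cst_uminus)
  have sum: "(\<Sum>v\<in>{p0, p1, p2, p3}. Cst (u v) * v) =
      Cst (u p0) * p0 + Cst (u p1) * p1 + Cst (u p2) * p2 + Cst (u p3) * p3" for u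
    using dist by (simp add: add_ac)
  have "kvec.independent {p0, p1, p2, p3}"
  proof (rule kvec.independent_if_scalars_zero)
    fix u v assume "(\<Sum>v\<in>{p0, p1, p2, p3}. Cst (u v) * v) = 0" "v \<in> {p0, p1, p2, p3}"
    then show "u v = 0" unfolding sum using indep[of "u p0" "u p1" "u p2" "u p3"] by auto
  qed simp
  moreover have "P \<in> kvec.span {p0, p1, p2, p3} \<longleftrightarrow> P \<in> U" for P
  proof
    assume "P \<in> kvec.span {p0, p1, p2, p3}"
    then have "P \<in> range (\<lambda>u. \<Sum>v\<in>{p0, p1, p2, p3}. Cst (u v) * v)"
      by (subst (asm) kvec.span_finite) simp_all
    then obtain u where P: "P = (\<Sum>v\<in>{p0, p1, p2, p3}. Cst (u v) * v)" by (rule rangeE)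
    show "P \<in> U"
      by (rule R[THEN conjunct2, THEN spec, THEN iffD2]) (unfold P sum, intro exI, rule refl)
  next
    assume "P \<in> U"
    then obtain x0 x1 x2 x3 where P: "P = Cst x0 * p0 + Cst x1 * p1 + Cst x2 * p2 + Cst x3 * p3"
      using R by blast
    show "P \<in> kvec.span {p0, p1, p2, p3}"
      unfolding P by (intro kvec.span_add kvec.span_scale kvec.span_base) simp_all
  qed
  then have "kvec.span {p0, p1, p2, p3} = U" by blast
  ultimately show ?L using dist unfolding is_basis_def by simp
qed

lemma is_basis_4_span:
  fixes p0 :: "'k::field bigraded_poly"
  assumes "is_basis [p0, p1, p2, p3] U"
  shows "P \<in> U \<longleftrightarrow> (\<exists>x0 x1 x2 x3. P = Cst x0 * p0 + Cst x1 * p1 + Cst x2 * p2 + Cst x3 * p3)"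
  by (rule assms[unfolded is_basis_4_iff, THEN conjunct2, THEN spec])

text \<open>The change of basis is unipotent. It strips multiples of the first two elements from the
  other two.\<close>

lemma is_basis_shear:
  fixes p0 :: "'k::field bigraded_poly"
  assumes p: "is_basis [p0, p1, Cst c * p0 + Cst d * p1 + p2, Cst c' * p0 + Cst d' * p1 + p3] U"
  shows "is_basis [p0, p1, p2, p3] U"
  unfolding is_basis_4_iff
proof (intro conjI allI impI)
  fix x0 x1 x2 x3
  assume "Cst x0 * p0 + Cst x1 * p1 + Cst x2 * p2 + Cst x3 * p3 = 0"
  then have "Cst (x0 - x2 * c - x3 * c') * p0 + Cst (x1 - x2 * d - x3 * d') * p1 +
      Cst x2 * (Cst c * p0 + Cst d * p1 + p2) + Cst x3 * (Cst c' * p0 + Cst d' * p1 + p3) = 0"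
    unfolding Cst_simps by Groebner_Basis.algebra
  from is_basis_4_independent[OF p this] show "x0 = 0" "x1 = 0" "x2 = 0" "x3 = 0" by auto
next
  fix P
  show "P \<in> U \<longleftrightarrow> (\<exists>x0 x1 x2 x3. P = Cst x0 * p0 + Cst x1 * p1 + Cst x2 * p2 + Cst x3 * p3)"
  proof
    assume "P \<in> U"
    then obtain x0 x1 x2 x3 where "P = Cst x0 * p0 + Cst x1 * p1 +
        Cst x2 * (Cst c * p0 + Cst d * p1 + p2) + Cst x3 * (Cst c' * p0 + Cst d' * p1 + p3)"
      unfolding is_basis_4_span[OF p] by (elim exE)
    then have "P = Cst (x0 + x2 * c + x3 * c') * p0 + Cst (x1 + x2 * d + x3 * d') * p1 +
        Cst x2 * p2 + Cst x3 * p3"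
      unfolding Cst_simps by Groebner_Basis.algebra
    then show "\<exists>x0 x1 x2 x3. P = Cst x0 * p0 + Cst x1 * p1 + Cst x2 * p2 + Cst x3 * p3" by blast
  next
    assume "\<exists>x0 x1 x2 x3. P = Cst x0 * p0 + Cst x1 * p1 + Cst x2 * p2 + Cst x3 * p3"
    then obtain x0 x1 x2 x3 where "P = Cst x0 * p0 + Cst x1 * p1 + Cst x2 * p2 + Cst x3 * p3" by blast
    then have "P = Cst (x0 - x2 * c - x3 * c') * p0 + Cst (x1 - x2 * d - x3 * d') * p1 +
      Cst x2 * (Cst c * p0 + Cst d * p1 + p2) + Cst x3 * (Cst c' * p0 + Cst d' * p1 + p3)"
      unfolding Cst_simps by Groebner_Basis.algebra
    then show "P \<in> U" unfolding is_basis_4_span[OF p] by (intro exI)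
  qed
qed

lemma subst_st_simps [simp]:
  "subst_st c11 c12 c21 c22 (f + g) = subst_st c11 c12 c21 c22 f + subst_st c11 c12 c21 c22 g"
  "subst_st c11 c12 c21 c22 (f * g) = subst_st c11 c12 c21 c22 f * subst_st c11 c12 c21 c22 g"
  "subst_st c11 c12 c21 c22 (f ^ n) = subst_st c11 c12 c21 c22 f ^ n"
  "subst_st c11 c12 c21 c22 0 = 0"
  "subst_st c11 c12 c21 c22 (Cst c) = Cst c"
  "subst_st c11 c12 c21 c22 Xs = Cst c11 * Xs + Cst c12 * Xt"
  "subst_st c11 c12 c21 c22 Xt = Cst c21 * Xs + Cst c22 * Xt"
  "subst_st c11 c12 c21 c22 Xu = Xu"
  "subst_st c11 c12 c21 c22 Xv = Xv"
  "subst_st c11 c12 c21 c22 (lform a b i) = lform a b i"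
  by (simp_all add: subst_st_def lform_def)

lemma is_basis_image:
  fixes p0 :: "'k::field bigraded_poly"
  assumes p: "is_basis [p0, p1, p2, p3] U" and inj: "\<And>f. subst_st c11 c12 c21 c22 f = 0 \<Longrightarrow> f = 0"
  defines "F \<equiv> subst_st c11 c12 c21 c22"
  shows "is_basis [F p0, F p1, F p2, F p3] (F ` U)"
  unfolding is_basis_4_iff
proof (intro conjI allI impI)
  have F: "F (Cst x0 * p0 + Cst x1 * p1 + Cst x2 * p2 + Cst x3 * p3) =
      Cst x0 * F p0 + Cst x1 * F p1 + Cst x2 * F p2 + Cst x3 * F p3" for x0 x1 x2 x3
    by (simp add: F_def)
  {
    fix x0 x1 x2 x3
    assume "Cst x0 * F p0 + Cst x1 * F p1 + Cst x2 * F p2 + Cst x3 * F p3 = 0"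
    then have "F (Cst x0 * p0 + Cst x1 * p1 + Cst x2 * p2 + Cst x3 * p3) = 0"
      unfolding F .
    then have "Cst x0 * p0 + Cst x1 * p1 + Cst x2 * p2 + Cst x3 * p3 = 0"
      unfolding F_def by (rule inj)
    from is_basis_4_independent[OF p this] show "x0 = 0" "x1 = 0" "x2 = 0" "x3 = 0" by blast+
  }
  fix P
  note U = is_basis_4_span[OF p]
  show "P \<in> F ` U \<longleftrightarrow>
      (\<exists>x0 x1 x2 x3. P = Cst x0 * F p0 + Cst x1 * F p1 + Cst x2 * F p2 + Cst x3 * F p3)"
  proof
    assume "P \<in> F ` U"
    then obtain Q where "Q \<in> U" and P: "P = F Q" by blast
    then obtain x0 x1 x2 x3 where Q: "Q = Cst x0 * p0 + Cst x1 * p1 + Cst x2 * p2 + Cst x3 * p3"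
      unfolding U by (elim exE)
    show "\<exists>x0 x1 x2 x3. P = Cst x0 * F p0 + Cst x1 * F p1 + Cst x2 * F p2 + Cst x3 * F p3"
      unfolding P Q F by (intro exI) (rule refl)
  next
    assume "\<exists>x0 x1 x2 x3. P = Cst x0 * F p0 + Cst x1 * F p1 + Cst x2 * F p2 + Cst x3 * F p3"
    then obtain x0 x1 x2 x3 where
      P: "P = Cst x0 * F p0 + Cst x1 * F p1 + Cst x2 * F p2 + Cst x3 * F p3"
      by (elim exE)
    have "Cst x0 * p0 + Cst x1 * p1 + Cst x2 * p2 + Cst x3 * p3 \<in> U"
      unfolding U by (intro exI) (rule refl)
    then show "P \<in> F ` U" unfolding P F[symmetric] by (rule imageI)
  qed
qed

text \<open>\<open>K u\<close> and \<open>K v\<close> are independent because \<open>K\<close>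
  cancels; the dimension leaves room for exactly two more basis elements.\<close>

lemma basis_extension:
  fixes U :: "'k::field bigraded_poly set"
  assumes U: "kvec.subspace U" "kvec.dim U = 4" and K: "K \<noteq> 0" "K * Xu \<in> U" "K * Xv \<in> U"
  obtains x y where "is_basis [K * Xu, K * Xv, x, y] U"
proof -
  have zero: "c = 0 \<and> d = 0" if "Cst c * (K * Xu) + Cst d * (K * Xv) = 0" for c d
  proof -
    have "K * (Cst c * Xu + Cst d * Xv) = 0" using that by (simp add: algebra_simps)
    then have "Cst c * Xu + Cst d * Xv = Cst 0 * Xu + Cst 0 * Xv" using K by simp
    then show ?thesis unfolding uv_form_eq_iff .
  qed
  have neq: "K * Xu \<noteq> K * Xv" using zero[of 1 "-1"] by (auto simp: Cst_uminus)
  have "kvec.independent {K * Xu, K * Xv}"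
  proof (rule kvec.independent_if_scalars_zero)
    fix u v assume "(\<Sum>v\<in>{K * Xu, K * Xv}. Cst (u v) * v) = 0" "v \<in> {K * Xu, K * Xv}"
    then show "u v = 0" using zero[of "u (K * Xu)" "u (K * Xv)"] neq by auto
  qed simp
  then obtain B where B: "{K * Xu, K * Xv} \<subseteq> B" "B \<subseteq> U" "kvec.independent B" "U \<subseteq> kvec.span B"
    using kvec.maximal_independent_subset_extend[of "{K * Xu, K * Xv}" U] K by blast
  have card: "card B = 4" using kvec.basis_card_eq_dim[OF B(2,4,3)] U by simp
  then have fin: "finite B" by (simp add: card_ge_0_finite)
  have "card (B - {K * Xu, K * Xv}) = 2"
    using card_Diff_subset[OF _ B(1)] card neq by simp
  then obtain x y where xy: "B - {K * Xu, K * Xv} = {x, y}" "x \<noteq> y" by (auto simp: card_2_iff)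
  have "kvec.span B = U" using B U(1) kvec.span_minimal[of B U] by blast
  moreover have setB: "set [K * Xu, K * Xv, x, y] = B" using xy B(1) by auto
  moreover have "distinct [K * Xu, K * Xv, x, y]" using xy neq by auto
  ultimately have "is_basis [K * Xu, K * Xv, x, y] U"
    using B(3) unfolding is_basis_def setB by blast
  then show ?thesis by (rule that)
qed

section \<open>Linear changes of s and t\<close>

text \<open>Both products of a matrix with its inverse are recorded: one shows that the substitution
  carries the chosen forms to \<open>s\<close>, \<open>t\<close>, the other that it can be
  undone.\<close>

lemma inverse_2x2:
  fixes e1 e2 f1 f2 :: "'k::field"
  assumes "e1 * f2 - e2 * f1 \<noteq> 0"
  obtains g1 h1 g2 h2 where "g1 * h2 - h1 * g2 \<noteq> 0"
    "e1 * g1 + f1 * g2 = 1" "e1 * h1 + f1 * h2 = 0" "e2 * g1 + f2 * g2 = 0" "e2 * h1 + f2 * h2 = 1"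
    "g1 * e1 + h1 * e2 = 1" "g1 * f1 + h1 * f2 = 0" "g2 * e1 + h2 * e2 = 0" "g2 * f1 + h2 * f2 = 1"
proof -
  define i where "i = 1 / (e1 * f2 - e2 * f1)"
  have i: "(e1 * f2 - e2 * f1) * i = 1" using assms by (simp add: i_def)
  show ?thesis
  proof (rule that)
    have "(f2 * i) * (e1 * i) - (- f1 * i) * (- e2 * i) = i"
      using i by Groebner_Basis.algebra
    then show "(f2 * i) * (e1 * i) - (- f1 * i) * (- e2 * i) \<noteq> 0" using i by auto
  qed (use i in Groebner_Basis.algebra)+
qed

lemma piece_2_1_coordinates:
  fixes f :: "'k::field bigraded_poly"
  assumes f: "f \<in> piece 2 1"
    and \<sigma>: "\<sigma> = Cst e1 * Xs + Cst f1 * Xt" and \<tau>: "\<tau> = Cst e2 * Xs + Cst f2 * Xt"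
    and det: "e1 * f2 - e2 * f1 \<noteq> 0"
  obtains c d :: "nat \<Rightarrow> 'k" where
    "f = \<sigma>\<^sup>2 * lform c d 0 + \<sigma> * \<tau> * lform c d 1 + \<tau>\<^sup>2 * lform c d 2"
proof -
  obtain g1 h1 g2 h2 where "g1 * h2 - h1 * g2 \<noteq> 0"
    "e1 * g1 + f1 * g2 = 1" "e1 * h1 + f1 * h2 = 0" "e2 * g1 + f2 * g2 = 0" "e2 * h1 + f2 * h2 = 1"
    and inv: "g1 * e1 + h1 * e2 = 1" "g1 * f1 + h1 * f2 = 0" "g2 * e1 + h2 * e2 = 0" "g2 * f1 + h2 * f2 = 1"
    by (rule inverse_2x2[OF det])
  note inv' = inv[THEN arg_cong[of _ _ Cst], unfolded Cst_simps Cst_one Cst_0]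
  have lin: "Cst g * \<sigma> + Cst h * \<tau> =
      (Cst g * Cst e1 + Cst h * Cst e2) * Xs + (Cst g * Cst f1 + Cst h * Cst f2) * Xt" for g h
    unfolding \<sigma> \<tau> by Groebner_Basis.algebra
  have s: "Xs = Cst g1 * \<sigma> + Cst h1 * \<tau>" and t: "Xt = Cst g2 * \<sigma> + Cst h2 * \<tau>"
    unfolding lin inv' by simp_all
  obtain c d where f: "f = Xs\<^sup>2 * lform c d 0 + Xs * Xt * lform c d 1 + Xt\<^sup>2 * lform c d 2"
    using f by (rule piece_2_1E)
  \<comment> \<open>The induced action on coefficients of quadratic forms, indexed by the exponent
    of \<open>\<tau>\<close>. The repeated summands are the factor 2 in the mixed terms of
    \<open>s^2\<close> and \<open>t^2\<close>.\<close>
  define T where "T c i = (if i = 0 then g1 * g1 * c 0 + g1 * g2 * c 1 + g2 * g2 * c 2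
    else if i = 1 then g1 * h1 * c 0 + g1 * h1 * c 0 + (g1 * h2 + h1 * g2) * c 1 + g2 * h2 * c 2 + g2 * h2 * c 2
    else h1 * h1 * c 0 + h1 * h2 * c 1 + h2 * h2 * c 2)" for c :: "nat \<Rightarrow> 'k" and i :: nat
  have T0: "lform (T c) (T d) 0 = Cst g1 * Cst g1 * lform c d 0 + Cst g1 * Cst g2 * lform c d 1 +
      Cst g2 * Cst g2 * lform c d 2"
    unfolding lform_def T_def by (simp add: Cst_simps algebra_simps)
  have T1: "lform (T c) (T d) 1 = (Cst g1 * Cst h1 + Cst g1 * Cst h1) * lform c d 0 +
      (Cst g1 * Cst h2 + Cst h1 * Cst g2) * lform c d 1 + (Cst g2 * Cst h2 + Cst g2 * Cst h2) * lform c d 2"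
    unfolding lform_def T_def by (simp add: Cst_simps algebra_simps)
  have T2: "lform (T c) (T d) 2 = Cst h1 * Cst h1 * lform c d 0 + Cst h1 * Cst h2 * lform c d 1 +
      Cst h2 * Cst h2 * lform c d 2"
    unfolding lform_def T_def by (simp add: Cst_simps algebra_simps)
  have "f = \<sigma>\<^sup>2 * lform (T c) (T d) 0 + \<sigma> * \<tau> * lform (T c) (T d) 1 + \<tau>\<^sup>2 * lform (T c) (T d) 2"
    unfolding f s t T0 T1 T2 by Groebner_Basis.algebra
  then show ?thesis by (rule that)
qed

text \<open>\<open>B\<close> is a product of two linear forms. Independent factors serve as
  coordinates; proportional ones make \<open>B\<close> a multiple of \<open>\<sigma>^2\<close>, and
  then any independent \<open>\<tau>\<close> will do.\<close>

lemma adapted_coordinates: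
  fixes U :: "'k::alg_closed_field bigraded_poly set"
  assumes U: "kvec.subspace U"
    and B: "B = Cst c0 * Xs\<^sup>2 + Cst c1 * Xs * Xt + Cst c2 * Xt\<^sup>2" "B \<noteq> 0" "B * Xu \<in> U" "B * Xv \<in> U"
  obtains e1 f1 e2 f2 \<sigma> \<tau> where "e1 * f2 - e2 * f1 \<noteq> 0"
    "\<sigma> = Cst e1 * Xs + Cst f1 * Xt" "\<tau> = Cst e2 * Xs + Cst f2 * Xt"
    "\<sigma>\<^sup>2 * Xu \<in> U \<and> \<sigma>\<^sup>2 * Xv \<in> U \<or> \<sigma> * \<tau> * Xu \<in> U \<and> \<sigma> * \<tau> * Xv \<in> U"
proof -
  obtain e1 e2 f2 f1 where c: "c0 = e1 * e2" "c1 = e1 * f2 + f1 * e2" "c2 = f1 * f2"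
    by (rule quadratic_factors)
  define \<sigma> where "\<sigma> = Cst e1 * Xs + Cst f1 * Xt"
  define \<tau> where "\<tau> = Cst e2 * Xs + Cst f2 * Xt"
  have B_eq: "B = \<sigma> * \<tau>"
    unfolding B(1) c Cst_simps \<sigma>_def \<tau>_def by Groebner_Basis.algebra
  show ?thesis
  proof (cases "e1 * f2 - e2 * f1 = 0")
    case False
    then show ?thesis
      using that[of e1 f2 e2 f1 \<sigma> \<tau>] B(3,4) B_eq by (simp add: \<sigma>_def \<tau>_def)
  next
    case True
    have "e1 \<noteq> 0 \<or> f1 \<noteq> 0" using B(2) B_eq by (auto simp: \<sigma>_def)
    then obtain l where l: "e2 = l * e1" "f2 = l * f1"
    proof
      assume "e1 \<noteq> 0"
      then show ?thesis using that[of "e2 / e1"] True by (simp add: field_simps)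
    next
      assume "f1 \<noteq> 0"
      then show ?thesis using that[of "f2 / f1"] True by (simp add: field_simps)
    qed
    have B_sq: "B = Cst l * \<sigma>\<^sup>2"
      unfolding B_eq \<tau>_def l Cst_mult \<sigma>_def by Groebner_Basis.algebra
    then have "l \<noteq> 0" using B(2) by auto
    then have "Cst (1 / l) * Cst l = 1" by (simp flip: Cst_mult)
    then have sq: "\<sigma>\<^sup>2 * X = Cst (1 / l) * (B * X)" for X
      unfolding B_sq by Groebner_Basis.algebra
    have in_U: "\<sigma>\<^sup>2 * Xu \<in> U" "\<sigma>\<^sup>2 * Xv \<in> U"
      unfolding sq using B(3,4) by (auto intro: kvec.subspace_scale[OF U])
    \<comment> \<open>\<open>\<sigma>\<close> is completed by \<open>s\<close> if it is a multiple
      of \<open>t\<close>, and by \<open>t\<close> otherwise.\<close>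
    show ?thesis
    proof (cases "e1 = 0")
      case True
      then show ?thesis
        using that[of e1 0 1 f1 \<sigma> Xs] in_U \<open>e1 \<noteq> 0 \<or> f1 \<noteq> 0\<close> by (simp add: \<sigma>_def)
    next
      case False
      then show ?thesis
        using that[of e1 1 0 f1 \<sigma> Xt] in_U by (simp add: \<sigma>_def)
    qed
  qed
qed

text \<open>The basis is shaped inside \<open>U\<close> in terms of \<open>\<sigma>\<close> and
  \<open>\<tau>\<close>, and the substitution is applied last, so the hypotheses on \<open>U\<close>
  never have to be transported.\<close>

lemma normal_form_exists:
  fixes U :: "'k::alg_closed_field bigraded_poly set"
  assumes U: "kvec.subspace U" "U \<subseteq> piece 2 1" "kvec.dim U = 4"
    and p: "is_basis p U" and bpf: "basepoint_free p" and uniq: "unique_first_syzygy p 0 1"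
  shows "\<exists>c11 c12 c21 c22 p' a b \<alpha> \<beta>.
        c11 * c22 - c12 * c21 \<noteq> 0 \<and>
        is_basis p' (subst_st c11 c12 c21 c22 ` U) \<and>
        qform a b \<noteq> 0 \<and>
        (normal_form1 a b \<alpha> \<beta> p' \<or> normal_form2 a b \<alpha> \<beta> p')"
proof -
  obtain B c0 c1 c2 where
    B: "B = Cst c0 * Xs\<^sup>2 + Cst c1 * Xs * Xt + Cst c2 * Xt\<^sup>2" "B \<noteq> 0" "B * Xu \<in> U" "B * Xv \<in> U"
    and "\<forall>P\<in>U. \<forall>Q\<in>U. Xu * P + Xv * Q = 0 \<longrightarrow>
      (\<exists>c. P = Cst c * (B * Xv) \<and> Q = - (Cst c * (B * Xu)))"
    by (rule unique_syzygyE[OF p U(2) uniq])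
  obtain e1 f2 e2 f1 \<sigma> \<tau> where det: "e1 * f2 - e2 * f1 \<noteq> 0"
    and \<sigma>: "\<sigma> = Cst e1 * Xs + Cst f1 * Xt" and \<tau>: "\<tau> = Cst e2 * Xs + Cst f2 * Xt"
    and K: "\<sigma>\<^sup>2 * Xu \<in> U \<and> \<sigma>\<^sup>2 * Xv \<in> U \<or> \<sigma> * \<tau> * Xu \<in> U \<and> \<sigma> * \<tau> * Xv \<in> U"
    by (rule adapted_coordinates[OF U(1) B])
  obtain g1 h2 h1 g2 where g: "g1 * h2 - h1 * g2 \<noteq> 0"
    and right: "e1 * g1 + f1 * g2 = 1" "e1 * h1 + f1 * h2 = 0" "e2 * g1 + f2 * g2 = 0" "e2 * h1 + f2 * h2 = 1"
    and left: "g1 * e1 + h1 * e2 = 1" "g1 * f1 + h1 * f2 = 0" "g2 * e1 + h2 * e2 = 0" "g2 * f1 + h2 * f2 = 1"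
    by (rule inverse_2x2[OF det])
  note right' = right[THEN arg_cong[of _ _ Cst], unfolded Cst_simps Cst_one Cst_0]
  note left' = left[THEN arg_cong[of _ _ Cst], unfolded Cst_simps Cst_one Cst_0]
  \<comment> \<open>\<open>F\<close> carries \<open>\<sigma>\<close>, \<open>\<tau>\<close> to
    \<open>s\<close>, \<open>t\<close>; its left inverse \<open>G\<close> provides
    injectivity.\<close>
  define F where "F = subst_st g1 h1 g2 h2"
  define G where "G = subst_st e1 f1 e2 f2"
  have lin: "A * (C * Xs + D * Xt) + A' * (C' * Xs + D' * Xt) =
      (A * C + A' * C') * Xs + (A * D + A' * D') * Xt" for A A' C C' D D' :: "'k bigraded_poly"
    by Groebner_Basis.algebra
  have F_\<sigma>: "F \<sigma> = Xs" and F_\<tau>: "F \<tau> = Xt"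
    by (simp_all add: F_def \<sigma> \<tau> lin right')
  have "G (F f) = f" for f
  proof (induction f rule: bigraded_poly_induct)
    case (Var x)
    show ?case by (cases x) (simp_all add: F_def G_def lin left')
  qed (simp_all add: F_def G_def)
  moreover have "G 0 = 0" by (simp add: G_def)
  ultimately have F_inj: "f = 0" if "subst_st g1 h1 g2 h2 f = 0" for f
    using that unfolding F_def by metis
  have F_simps [simp]: "F (f + f') = F f + F f'" "F (f * f') = F f * F f'" "F (f ^ n) = F f ^ n"
    "F Xu = Xu" "F Xv = Xv" "F (lform a b i) = lform a b i" for f f' n a b i
    by (simp_all add: F_def)
  have \<sigma>\<tau>0: "\<sigma> \<noteq> 0" "\<tau> \<noteq> 0" using F_\<sigma> F_\<tau> by (auto simp: F_def)
  from K show ?thesis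
  proof (elim disjE conjE)
    assume K: "\<sigma>\<^sup>2 * Xu \<in> U" "\<sigma>\<^sup>2 * Xv \<in> U"
    obtain x y where xy: "is_basis [\<sigma>\<^sup>2 * Xu, \<sigma>\<^sup>2 * Xv, x, y] U"
      using basis_extension[OF U(1,3) _ K] \<sigma>\<tau>0 by auto
    then have "x \<in> piece 2 1" "y \<in> piece 2 1"
      using U(2) kvec.span_base[of _ "set [\<sigma>\<^sup>2 * Xu, \<sigma>\<^sup>2 * Xv, x, y]"] by (auto simp: is_basis_def)
    then obtain c d c' d' where
      x: "x = \<sigma>\<^sup>2 * lform c d 0 + \<sigma> * \<tau> * lform c d 1 + \<tau>\<^sup>2 * lform c d 2" and
      y: "y = \<sigma>\<^sup>2 * lform c' d' 0 + \<sigma> * \<tau> * lform c' d' 1 + \<tau>\<^sup>2 * lform c' d' 2"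
      using piece_2_1_coordinates[OF _ \<sigma> \<tau> det] by metis
    \<comment> \<open>Coefficients of \<open>\<sigma> \<tau>\<close> and \<open>\<tau>^2\<close>;
      the \<open>\<sigma>^2\<close> parts lie in the span of the first two basis elements and are
      sheared off.\<close>
    define a where "a i = (if i = 1 then c 1 else if i = 2 then c 2 else if i = 3 then c' 1 else c' 2)"
      for i :: nat
    define b where "b i = (if i = 1 then d 1 else if i = 2 then d 2 else if i = 3 then d' 1 else d' 2)"
      for i :: nat
    have ab: "lform a b 1 = lform c d 1" "lform a b 2 = lform c d 2"
      "lform a b 3 = lform c' d' 1" "lform a b 4 = lform c' d' 2"
      by (simp_all add: lform_def a_def b_def)
    have x': "x = Cst (c 0) * (\<sigma>\<^sup>2 * Xu) + Cst (d 0) * (\<sigma>\<^sup>2 * Xv) +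
        (\<sigma> * \<tau> * lform a b 1 + \<tau>\<^sup>2 * lform a b 2)"
      unfolding ab x lform_def[of c d 0] by Groebner_Basis.algebra
    have y': "y = Cst (c' 0) * (\<sigma>\<^sup>2 * Xu) + Cst (d' 0) * (\<sigma>\<^sup>2 * Xv) +
        (\<sigma> * \<tau> * lform a b 3 + \<tau>\<^sup>2 * lform a b 4)"
      unfolding ab y lform_def[of c' d' 0] by Groebner_Basis.algebra
    have basis: "is_basis [\<sigma>\<^sup>2 * Xu, \<sigma>\<^sup>2 * Xv, \<sigma> * \<tau> * lform a b 1 + \<tau>\<^sup>2 * lform a b 2,
        \<sigma> * \<tau> * lform a b 3 + \<tau>\<^sup>2 * lform a b 4] U"
      by (rule is_basis_shear[OF xy[unfolded x' y']])
    obtain \<alpha> \<beta> where "qform a b = lform \<alpha> \<beta> 1 * lform \<alpha> \<beta> 2" by (rule lform_factorization)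
    then have "normal_form1 a b \<alpha> \<beta> [F (\<sigma>\<^sup>2 * Xu), F (\<sigma>\<^sup>2 * Xv),
        F (\<sigma> * \<tau> * lform a b 1 + \<tau>\<^sup>2 * lform a b 2), F (\<sigma> * \<tau> * lform a b 3 + \<tau>\<^sup>2 * lform a b 4)]"
      by (simp add: normal_form1_def F_\<sigma> F_\<tau>)
    with g is_basis_image[OF basis F_inj] case1_nondegenerate(2)[OF p U(2) bpf uniq \<sigma> \<tau> det basis]
    show ?thesis unfolding F_def by blast
  next
    assume K: "\<sigma> * \<tau> * Xu \<in> U" "\<sigma> * \<tau> * Xv \<in> U"
    obtain x y where xy: "is_basis [\<sigma> * \<tau> * Xu, \<sigma> * \<tau> * Xv, x, y] U"
      using basis_extension[OF U(1,3) _ K] \<sigma>\<tau>0 by auto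
    then have "x \<in> piece 2 1" "y \<in> piece 2 1"
      using U(2) kvec.span_base[of _ "set [\<sigma> * \<tau> * Xu, \<sigma> * \<tau> * Xv, x, y]"] by (auto simp: is_basis_def)
    then obtain c d c' d' where
      x: "x = \<sigma>\<^sup>2 * lform c d 0 + \<sigma> * \<tau> * lform c d 1 + \<tau>\<^sup>2 * lform c d 2" and
      y: "y = \<sigma>\<^sup>2 * lform c' d' 0 + \<sigma> * \<tau> * lform c' d' 1 + \<tau>\<^sup>2 * lform c' d' 2"
      using piece_2_1_coordinates[OF _ \<sigma> \<tau> det] by metis
    \<comment> \<open>Now the coefficients of \<open>\<sigma>^2\<close> and \<open>\<tau>^2\<close>
      are kept, and the \<open>\<sigma> \<tau>\<close> parts are sheared off.\<close>
    define a where "a i = (if i = 1 then c 0 else if i = 2 then c 2 else if i = 3 then c' 0 else c' 2)"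
      for i :: nat
    define b where "b i = (if i = 1 then d 0 else if i = 2 then d 2 else if i = 3 then d' 0 else d' 2)"
      for i :: nat
    have ab: "lform a b 1 = lform c d 0" "lform a b 2 = lform c d 2"
      "lform a b 3 = lform c' d' 0" "lform a b 4 = lform c' d' 2"
      by (simp_all add: lform_def a_def b_def)
    have x': "x = Cst (c 1) * (\<sigma> * \<tau> * Xu) + Cst (d 1) * (\<sigma> * \<tau> * Xv) +
        (\<sigma>\<^sup>2 * lform a b 1 + \<tau>\<^sup>2 * lform a b 2)"
      unfolding ab x lform_def[of c d 1] by Groebner_Basis.algebra
    have y': "y = Cst (c' 1) * (\<sigma> * \<tau> * Xu) + Cst (d' 1) * (\<sigma> * \<tau> * Xv) +
        (\<sigma>\<^sup>2 * lform a b 3 + \<tau>\<^sup>2 * lform a b 4)"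
      unfolding ab y lform_def[of c' d' 1] by Groebner_Basis.algebra
    have basis: "is_basis [\<sigma> * \<tau> * Xu, \<sigma> * \<tau> * Xv, \<sigma>\<^sup>2 * lform a b 1 + \<tau>\<^sup>2 * lform a b 2,
        \<sigma>\<^sup>2 * lform a b 3 + \<tau>\<^sup>2 * lform a b 4] U"
      by (rule is_basis_shear[OF xy[unfolded x' y']])
    obtain \<alpha> \<beta> where "qform a b = lform \<alpha> \<beta> 1 * lform \<alpha> \<beta> 2" by (rule lform_factorization)
    then have "normal_form2 a b \<alpha> \<beta> [F (\<sigma> * \<tau> * Xu), F (\<sigma> * \<tau> * Xv),
        F (\<sigma>\<^sup>2 * lform a b 1 + \<tau>\<^sup>2 * lform a b 2), F (\<sigma>\<^sup>2 * lform a b 3 + \<tau>\<^sup>2 * lform a b 4)]"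
      by (simp add: normal_form2_def F_\<sigma> F_\<tau>)
    with g is_basis_image[OF basis F_inj] case2_nondegenerate(3)[OF p U(2) bpf uniq \<sigma> \<tau> det basis]
    show ?thesis unfolding F_def by blast
  qed
qed

lemma lform_neq_0:
  assumes "a i * b j - a j * b i \<noteq> (0::'k::field)"
  shows "lform a b i \<noteq> 0" "lform a b j \<noteq> 0"
proof -
  have "lform a b k = 0 \<longleftrightarrow> a k = 0 \<and> b k = 0" for k
    using uv_form_eq_iff[of "a k" "b k" 0 0] by (simp add: lform_def)
  with assms show "lform a b i \<noteq> 0" "lform a b j \<noteq> 0" by auto
qed

theorem theorem3p3:
  fixes U :: "'k::alg_closed_field bigraded_poly set"
    and p :: "'k bigraded_poly list"
  assumes "kvec.subspace U" and "U \<subseteq> piece 2 1" and "kvec.dim U = 4"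
    and "is_basis p U"
    and "basepoint_free p"
    and "unique_first_syzygy p 0 1"
  shows
    "(\<exists>c11 c12 c21 c22 p' a b \<alpha> \<beta>.
        c11 * c22 - c12 * c21 \<noteq> 0 \<and>
        is_basis p' (subst_st c11 c12 c21 c22 ` U) \<and>
        qform a b \<noteq> 0 \<and>
        (normal_form1 a b \<alpha> \<beta> p' \<or> normal_form2 a b \<alpha> \<beta> p')) \<and>
     (\<forall>a b \<alpha> \<beta>. normal_form1 a b \<alpha> \<beta> p \<longrightarrow>
        exact_resolution p
          [(-4, -2), (-4, -2)]
          [(-2, -2), (-3, -2), (-3, -2), (-4, -1), (-4, -1)]
          [(-2, -1), (-2, -1), (-2, -1), (-2, -1)]
          (phi3_case1 a b \<alpha> \<beta>) (phi2_case1 a b \<alpha> \<beta>)) \<and>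
     (\<forall>a b \<alpha> \<beta>. normal_form2 a b \<alpha> \<beta> p \<longrightarrow>
        exact_resolution p
          [(-4, -2), (-4, -2)]
          [(-2, -2), (-3, -2), (-3, -2), (-4, -1), (-4, -1)]
          [(-2, -1), (-2, -1), (-2, -1), (-2, -1)]
          (phi3_case2 a b \<alpha> \<beta>) (phi2_case2 a b \<alpha> \<beta>))"
proof (intro conjI allI impI)
  \<comment> \<open>The nondegeneracy lemmas are applied with \<open>\<sigma> = s\<close> and
    \<open>\<tau> = t\<close>, that is, with the identity matrix of coefficients.\<close>
  have s: "Xs = Cst 1 * Xs + Cst 0 * (Xt :: 'k bigraded_poly)"
    and t: "Xt = Cst 0 * Xs + Cst 1 * (Xt :: 'k bigraded_poly)" by simp_all
  have det: "1 * 1 - 0 * 0 \<noteq> (0 :: 'k)" by simp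
  note hyps = assms(4,2,5,6) s t det
  fix a b \<alpha> \<beta>
  {
    assume nf: "normal_form1 a b \<alpha> \<beta> p"
    with assms(4) have basis: "is_basis [Xs\<^sup>2 * Xu, Xs\<^sup>2 * Xv, Xs * Xt * lform a b 1 + Xt\<^sup>2 * lform a b 2,
      Xs * Xt * lform a b 3 + Xt\<^sup>2 * lform a b 4] U"
      by (simp add: normal_form1_def)
    note nd = case1_nondegenerate[OF hyps basis]
    show "exact_resolution p
          [(-4, -2), (-4, -2)]
          [(-2, -2), (-3, -2), (-3, -2), (-4, -1), (-4, -1)]
          [(-2, -1), (-2, -1), (-2, -1), (-2, -1)]
          (phi3_case1 a b \<alpha> \<beta>) (phi2_case1 a b \<alpha> \<beta>)"
      by (rule exact_resolution_case1[OF nf nd lform_neq_0(2)[OF nd(1)]])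
  next
    assume nf: "normal_form2 a b \<alpha> \<beta> p"
    with assms(4) have basis: "is_basis [Xs * Xt * Xu, Xs * Xt * Xv, Xs\<^sup>2 * lform a b 1 + Xt\<^sup>2 * lform a b 2,
      Xs\<^sup>2 * lform a b 3 + Xt\<^sup>2 * lform a b 4] U"
      by (simp add: normal_form2_def)
    note nd = case2_nondegenerate[OF hyps basis]
    show "exact_resolution p
          [(-4, -2), (-4, -2)]
          [(-2, -2), (-3, -2), (-3, -2), (-4, -1), (-4, -1)]
          [(-2, -1), (-2, -1), (-2, -1), (-2, -1)]
          (phi3_case2 a b \<alpha> \<beta>) (phi2_case2 a b \<alpha> \<beta>)"
      by (rule exact_resolution_case2[OF nf nd lform_neq_0(2)[OF nd(1)] lform_neq_0(2)[OF nd(2)]])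
  }
qed (rule normal_form_exists[OF assms])

end
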